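(* The category $\mathsf{SLataSp}$ of SLata-spaces and SLata-relations and the category $\mathsf{SLata}$ of SLatas and SLata morphisms are dually equivalent.
   Context: SEMILATTICES. A semilattice is an algebra $\mathbf{A}=\langle A,\wedge,1\rangle$ with $\wedge$ idempotent, commutative, associative and $a\wedge 1=a$ for all $a$; its order is $a\le b$ iff $a=a\wedge b$. A homomorphism preserves $\wedge$ and $1$. For unary operators $i,d$ on $A$, $i\dashv d$ means: for all $a,b\in A$, $i(a)\le b$ iff $a\le d(b)$. An SLata is an algebra $\langle\mathbf{A},i,d\rangle$ with $\mathbf{A}$ a semilattice and $i\dashv d$. An SLata morphism $h:\langle\mathbf{A}_1,i_1,d_1\rangle\to\langle\mathbf{A}_2,i_2,d_2\rangle$ is a semilattice homomorphism with $h(i_1(a))=i_2(h(a))$ and $h(d_1(a))=d_2(h(a))$ for all $a$. $\mathsf{SLata}$ is the category of SLatas and SLata morphisms with usual composition and identity maps. S-SPACES. A pair $\langle X,\mathcal{K}\rangle$ denotes a set $X$ with the topology having $\mathcal{K}$, a family of subsets of $X$, as subbase. Put $S(X)=\{U^c:U\in\mathcal{K}\}$ (complements in $X$) and $C_{\mathcal{K}}(X)=\{\bigcap\mathcal{A}:\mathcal{A}\subseteq S(X)\}$. For $Y\subseteq X$, a nonempty $\mathcal{J}\subseteq S(X)$ is a $Y$-family if for all $A,B\in\mathcal{J}$ there are $H,C\in S(X)$ with $Y\subseteq H$, $C\in\mathcal{J}$, $A\cap H\subseteq C$ and $B\cap H\subseteq C$. $\langle X,\mathcal{K}\rangle$ is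 an $S$-space if: (S1) it is $T_0$ and $X=\bigcup\mathcal{K}$; (S2) $\mathcal{K}$ is a subbase of compact open subsets, closed under finite unions, with $\emptyset\in\mathcal{K}$; (S3) for $U,V\in\mathcal{K}$ and $x\in U\cap V$ there are $W,D\in\mathcal{K}$ with $x\notin W$, $x\in D$, $D\subseteq(U\cap V)\cup W$; (S4) if $Y\in C_{\mathcal{K}}(X)$ and $\mathcal{J}$ is a $Y$-family with $Y\cap A^c\ne\emptyset$ for all $A\in\mathcal{J}$, then $Y\cap\bigcap\{A^c:A\in\mathcal{J}\}\neq\emptyset$. SLATA-SPACES. For an $S$-space $\langle X,\mathcal{K}\rangle$, $\mathcal{Z}(X)$ is the set of subsets of $X$ that are (possibly infinite) intersections of members of $\mathcal{K}$; for $U\in S(X)$, $L_U=\{Z\in\mathcal{Z}(X):Z\cap U\ne\emptyset\}$. For $R\subseteq X\times\mathcal{Z}(X)$ let $R(x)=\{Z:(x,Z)\in R\}$ and $m_R(U)=\{x\in X:R(x)\subseteq L_U\}$. $\langle X,\mathcal{K},R\rangle$ is an $mS$-space if $m_R(U)\in S(X)$ for all $U\in S(X)$ and $R(x)=\bigcap\{L_U:U\in S(X),x\in m_R(U)\}$ for all $x\in X$. $\langle X,\mathcal{K},I,D\rangle$ is an SLata-space if: (1) $\langle X,\mathcal{K},I\rangle$ and $\langle X,\mathcal{K},D\rangle$ are $mS$-spaces; (2) for every $U\in S(X)$, if $x\in U$ then for every $Z\in D(x)$ there is $w\in Z$ with $I(w)\subseteq L_U$; (3) for every $U\in S(X)$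 and $x \in X$, if for every $Z\in I(x)$ there is $y\in Z$ with $D(y)\subseteq L_U$, then $x\in U$. RELATIONS. For $T\subseteq X_1\times X_2$ let $T(x)=\{y:(x,y)\in T\}$ and $\Box_T(U)=\{x\in X_1:T(x)\subseteq U\}$. A meet-relation between $S$-spaces is $T\subseteq X_1\times X_2$ with $\Box_T(U)\in S(X_1)$ for all $U\in S(X_2)$ and $T(x)=\bigcap\{U\in S(X_2):T(x)\subseteq U\}$ for all $x\in X_1$. An SLata-relation between SLata-spaces $\langle X_1,\mathcal{K}_1,I_1,D_1\rangle$ and $\langle X_2,\mathcal{K}_2,I_2,D_2\rangle$ is a meet-relation $T$ with $\Box_T\circ m_{I_2}=m_{I_1}\circ\Box_T$ and $\Box_T\circ m_{D_2}=m_{D_1}\circ\Box_T$ on $S(X_2)$. For $R\subseteq X_1\times X_2$ and $T\subseteq X_2\times X_3$, $T\ast R=\{(x,z)\in X_1\times X_3:\forall U\in S(X_3)\,[(T\circ R)(x)\subseteq U\Rightarrow z\in U]\}$, where $T\circ R$ is the usual relational composition ($R$ first). $\mathsf{SLataSp}$ is the category of SLata-spaces and SLata-relations with composition $\ast$ and identity on $X$ the dual specialization order $\sqsupseteq$ ($x\sqsupseteq y$ iff $y\in\mathrm{cl}(\{x\})$). *)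

theory Defs
  imports "HOL-Analysis.Analysis" "HOL-Algebra.Group" "HOL-Library.Equipollence"
begin

section \<open>Categories and dual equivalence\<close>

text \<open>The same HOL value may be a morphism between several pairs of objects, so homs,
  composition and functor actions are indexed by objects: \<open>Comp C X Y Z g f\<close> is the composite of
  \<open>f : X \<rightarrow> Y\<close> and \<open>g : Y \<rightarrow> Z\<close>.\<close>

record ('o, 'm) category =
  Obj :: "'o set"
  Hom :: "'o \<Rightarrow> 'o \<Rightarrow> 'm set"
  Idm :: "'o \<Rightarrow> 'm"
  Comp :: "'o \<Rightarrow> 'o \<Rightarrow> 'o \<Rightarrow> 'm \<Rightarrow> 'm \<Rightarrow> 'm"

definition is_category :: "('o, 'm) category \<Rightarrow> bool" where
  "is_category C \<longleftrightarrow>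
     (\<forall>X\<in>Obj C. Idm C X \<in> Hom C X X) \<and>
     (\<forall>X\<in>Obj C. \<forall>Y\<in>Obj C. \<forall>Z\<in>Obj C. \<forall>f\<in>Hom C X Y. \<forall>g\<in>Hom C Y Z.
        Comp C X Y Z g f \<in> Hom C X Z) \<and>
     (\<forall>X\<in>Obj C. \<forall>Y\<in>Obj C. \<forall>f\<in>Hom C X Y.
        Comp C X X Y f (Idm C X) = f \<and> Comp C X Y Y (Idm C Y) f = f) \<and>
     (\<forall>W\<in>Obj C. \<forall>X\<in>Obj C. \<forall>Y\<in>Obj C. \<forall>Z\<in>Obj C.
        \<forall>f\<in>Hom C W X. \<forall>g\<in>Hom C X Y. \<forall>h\<in>Hom C Y Z.
        Comp C W Y Z h (Comp C W X Y g f) = Comp C W X Z (Comp C X Y Z h g) f)"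

definition opposite :: "('o, 'm) category \<Rightarrow> ('o, 'm) category" where
  "opposite C = \<lparr>Obj = Obj C, Hom = (\<lambda>X Y. Hom C Y X), Idm = Idm C,
     Comp = (\<lambda>X Y Z g f. Comp C Z Y X f g)\<rparr>"

definition is_iso :: "('o, 'm) category \<Rightarrow> 'o \<Rightarrow> 'o \<Rightarrow> 'm \<Rightarrow> bool" where
  "is_iso C X Y f \<longleftrightarrow> f \<in> Hom C X Y \<and>
     (\<exists>g\<in>Hom C Y X. Comp C X Y X g f = Idm C X \<and> Comp C Y X Y f g = Idm C Y)"

record ('o1, 'm1, 'o2, 'm2) functr =
  OMap :: "'o1 \<Rightarrow> 'o2"
  MMap :: "'o1 \<Rightarrow> 'o1 \<Rightarrow> 'm1 \<Rightarrow> 'm2"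

definition is_functor ::
  "('o1, 'm1) category \<Rightarrow> ('o2, 'm2) category \<Rightarrow> ('o1, 'm1, 'o2, 'm2) functr \<Rightarrow> bool" where
  "is_functor C D F \<longleftrightarrow>
     (\<forall>X\<in>Obj C. OMap F X \<in> Obj D) \<and>
     (\<forall>X\<in>Obj C. \<forall>Y\<in>Obj C. \<forall>f\<in>Hom C X Y. MMap F X Y f \<in> Hom D (OMap F X) (OMap F Y)) \<and>
     (\<forall>X\<in>Obj C. MMap F X X (Idm C X) = Idm D (OMap F X)) \<and>
     (\<forall>X\<in>Obj C. \<forall>Y\<in>Obj C. \<forall>Z\<in>Obj C. \<forall>f\<in>Hom C X Y. \<forall>g\<in>Hom C Y Z.
        MMap F X Z (Comp C X Y Z g f) =
          Comp D (OMap F X) (OMap F Y) (OMap F Z) (MMap F Y Z g) (MMap F X Y f))"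

definition id_functor :: "('o, 'm, 'o, 'm) functr" where
  "id_functor = \<lparr>OMap = (\<lambda>X. X), MMap = (\<lambda>X Y f. f)\<rparr>"

definition comp_functor ::
  "('o2, 'm2, 'o3, 'm3) functr \<Rightarrow> ('o1, 'm1, 'o2, 'm2) functr \<Rightarrow> ('o1, 'm1, 'o3, 'm3) functr" where
  "comp_functor G F = \<lparr>OMap = (\<lambda>X. OMap G (OMap F X)),
     MMap = (\<lambda>X Y f. MMap G (OMap F X) (OMap F Y) (MMap F X Y f))\<rparr>"

definition natural_iso ::
  "('o1, 'm1) category \<Rightarrow> ('o2, 'm2) category \<Rightarrow> ('o1, 'm1, 'o2, 'm2) functr \<Rightarrow>
   ('o1, 'm1, 'o2, 'm2) functr \<Rightarrow> ('o1 \<Rightarrow> 'm2) \<Rightarrow> bool" where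
  "natural_iso C D F G \<tau> \<longleftrightarrow>
     (\<forall>X\<in>Obj C. is_iso D (OMap F X) (OMap G X) (\<tau> X)) \<and>
     (\<forall>X\<in>Obj C. \<forall>Y\<in>Obj C. \<forall>f\<in>Hom C X Y.
        Comp D (OMap F X) (OMap F Y) (OMap G Y) (\<tau> Y) (MMap F X Y f) =
        Comp D (OMap F X) (OMap G X) (OMap G Y) (MMap G X Y f) (\<tau> X))"

definition equivalent_categories :: "('o1, 'm1) category \<Rightarrow> ('o2, 'm2) category \<Rightarrow> bool" where
  "equivalent_categories C D \<longleftrightarrow> is_category C \<and> is_category D \<and>
     (\<exists>F G \<eta> \<epsilon>. is_functor C D F \<and> is_functor D C G \<and>
        natural_iso C C id_functor (comp_functor G F) \<eta> \<and>
        natural_iso D D (comp_functor F G) id_functor \<epsilon>)"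

definition dually_equivalent :: "('o1, 'm1) category \<Rightarrow> ('o2, 'm2) category \<Rightarrow> bool" where
  "dually_equivalent C D \<longleftrightarrow> equivalent_categories (opposite C) D"


section \<open>SLatas\<close>

text \<open>A semilattice is an idempotent commutative monoid: \<open>\<otimes>\<close> is the meet and \<open>\<one>\<close> the top element.\<close>

definition semilattice :: "('a, 'b) monoid_scheme \<Rightarrow> bool" where
  "semilattice A \<longleftrightarrow> comm_monoid A \<and> (\<forall>a\<in>carrier A. a \<otimes>\<^bsub>A\<^esub> a = a)"

definition sl_le :: "('a, 'b) monoid_scheme \<Rightarrow> 'a \<Rightarrow> 'a \<Rightarrow> bool" where
  "sl_le A a b \<longleftrightarrow> a = a \<otimes>\<^bsub>A\<^esub> b"

record 'a slata = "'a monoid" +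
  op_i :: "'a \<Rightarrow> 'a"
  op_d :: "'a \<Rightarrow> 'a"

definition is_slata :: "'a slata \<Rightarrow> bool" where
  "is_slata A \<longleftrightarrow> semilattice A \<and>
     op_i A \<in> carrier A \<rightarrow> carrier A \<and> op_d A \<in> carrier A \<rightarrow> carrier A \<and>
     (\<forall>a\<in>carrier A. \<forall>b\<in>carrier A. sl_le A (op_i A a) b \<longleftrightarrow> sl_le A a (op_d A b))"

text \<open>Morphisms are taken extensional, so that equality of morphisms is equality of functions on
  the carrier.\<close>

definition slata_hom :: "'a slata \<Rightarrow> 'a slata \<Rightarrow> ('a \<Rightarrow> 'a) set" where
  "slata_hom A B = {h \<in> hom A B \<inter> extensional (carrier A).
     h \<one>\<^bsub>A\<^esub> = \<one>\<^bsub>B\<^esub> \<and>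
     (\<forall>a\<in>carrier A. h (op_i A a) = op_i B (h a)) \<and>
     (\<forall>a\<in>carrier A. h (op_d A a) = op_d B (h a))}"

definition SLata :: "('a set \<Rightarrow> bool) \<Rightarrow> ('a slata, 'a \<Rightarrow> 'a) category" where
  "SLata small = \<lparr>Obj = {A. is_slata A \<and> small (carrier A)},
     Hom = slata_hom,
     Idm = (\<lambda>A. \<lambda>x\<in>carrier A. x),
     Comp = (\<lambda>A B C g f. compose (carrier A) g f)\<rparr>"


section \<open>\<open>S\<close>-spaces\<close>

definition S_fam :: "'x set \<Rightarrow> 'x set set \<Rightarrow> 'x set set" where
  "S_fam X K = {X - U | U. U \<in> K}"

text \<open>Intersections of families of subsets of \<open>X\<close> are formed inside \<open>X\<close>; the empty one is \<open>X\<close>.\<close>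

definition C_fam :: "'x set \<Rightarrow> 'x set set \<Rightarrow> 'x set set" where
  "C_fam X K = {X \<inter> \<Inter>\<A> | \<A>. \<A> \<subseteq> S_fam X K}"

definition Z_fam :: "'x set \<Rightarrow> 'x set set \<Rightarrow> 'x set set" where
  "Z_fam X K = {X \<inter> \<Inter>\<A> | \<A>. \<A> \<subseteq> K}"

definition Y_family :: "'x set \<Rightarrow> 'x set set \<Rightarrow> 'x set \<Rightarrow> 'x set set \<Rightarrow> bool" where
  "Y_family X K Y J \<longleftrightarrow> J \<noteq> {} \<and> J \<subseteq> S_fam X K \<and>
     (\<forall>A\<in>J. \<forall>B\<in>J. \<exists>H\<in>S_fam X K. \<exists>C\<in>S_fam X K.
        Y \<subseteq> H \<and> C \<in> J \<and> A \<inter> H \<subseteq> C \<and> B \<inter> H \<subseteq> C)"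

text \<open>Since \<open>X = \<Union>K\<close>, \<^term>\<open>topology_generated_by K\<close> is the topology on \<open>X\<close> with subbase \<open>K\<close>;
  in particular members of \<open>K\<close> are open in it.\<close>

definition S_space :: "'x set \<Rightarrow> 'x set set \<Rightarrow> bool" where
  "S_space X K \<longleftrightarrow>
     (t0_space (topology_generated_by K) \<and> X = \<Union>K) \<and>
     ((\<forall>U\<in>K. compactin (topology_generated_by K) U) \<and>
      (\<forall>U\<in>K. \<forall>V\<in>K. U \<union> V \<in> K) \<and> {} \<in> K) \<and>
     (\<forall>U\<in>K. \<forall>V\<in>K. \<forall>x\<in>U \<inter> V. \<exists>W\<in>K. \<exists>D\<in>K.
        x \<notin> W \<and> x \<in> D \<and> D \<subseteq> (U \<inter> V) \<union> W) \<and>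
     (\<forall>Y\<in>C_fam X K. \<forall>J. Y_family X K Y J \<and> (\<forall>A\<in>J. Y \<inter> (X - A) \<noteq> {}) \<longrightarrow>
        Y \<inter> \<Inter>{X - A | A. A \<in> J} \<noteq> {})"


section \<open>\<open>mS\<close>-spaces and SLata-spaces\<close>

definition L_fam :: "'x set \<Rightarrow> 'x set set \<Rightarrow> 'x set \<Rightarrow> 'x set set" where
  "L_fam X K U = {Z \<in> Z_fam X K. Z \<inter> U \<noteq> {}}"

definition m_op :: "'x set \<Rightarrow> 'x set set \<Rightarrow> ('x \<times> 'x set) set \<Rightarrow> 'x set \<Rightarrow> 'x set" where
  "m_op X K R U = {x \<in> X. R `` {x} \<subseteq> L_fam X K U}"

definition mS_space :: "'x set \<Rightarrow> 'x set set \<Rightarrow> ('x \<times> 'x set) set \<Rightarrow> bool" where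
  "mS_space X K R \<longleftrightarrow> S_space X K \<and> R \<subseteq> X \<times> Z_fam X K \<and>
     (\<forall>U\<in>S_fam X K. m_op X K R U \<in> S_fam X K) \<and>
     (\<forall>x\<in>X. R `` {x} =
        Z_fam X K \<inter> \<Inter>{L_fam X K U | U. U \<in> S_fam X K \<and> x \<in> m_op X K R U})"

record 'x slata_space =
  pts :: "'x set"
  subb :: "'x set set"
  rel_I :: "('x \<times> 'x set) set"
  rel_D :: "('x \<times> 'x set) set"

definition is_slata_space :: "'x slata_space \<Rightarrow> bool" where
  "is_slata_space P \<longleftrightarrow>
     (let X = pts P; K = subb P; I = rel_I P; D = rel_D P in
       mS_space X K I \<and> mS_space X K D \<and>
       (\<forall>U\<in>S_fam X K. \<forall>x\<in>U. \<forall>Z\<in>D `` {x}. \<exists>w\<in>Z. I `` {w} \<subseteq> L_fam X K U) \<and>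
       (\<forall>U\<in>S_fam X K. \<forall>x\<in>X.
          (\<forall>Z\<in>I `` {x}. \<exists>y\<in>Z. D `` {y} \<subseteq> L_fam X K U) \<longrightarrow> x \<in> U))"


section \<open>SLata-relations\<close>

definition box :: "'x set \<Rightarrow> ('x \<times> 'y) set \<Rightarrow> 'y set \<Rightarrow> 'x set" where
  "box X1 T U = {x \<in> X1. T `` {x} \<subseteq> U}"

definition meet_relation ::
  "'x set \<Rightarrow> 'x set set \<Rightarrow> 'y set \<Rightarrow> 'y set set \<Rightarrow> ('x \<times> 'y) set \<Rightarrow> bool" where
  "meet_relation X1 K1 X2 K2 T \<longleftrightarrow> T \<subseteq> X1 \<times> X2 \<and>
     (\<forall>U\<in>S_fam X2 K2. box X1 T U \<in> S_fam X1 K1) \<and>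
     (\<forall>x\<in>X1. T `` {x} = X2 \<inter> \<Inter>{U \<in> S_fam X2 K2. T `` {x} \<subseteq> U})"

definition slata_relations :: "'x slata_space \<Rightarrow> 'y slata_space \<Rightarrow> ('x \<times> 'y) set set" where
  "slata_relations P Q = {T. meet_relation (pts P) (subb P) (pts Q) (subb Q) T \<and>
     (\<forall>U\<in>S_fam (pts Q) (subb Q).
        box (pts P) T (m_op (pts Q) (subb Q) (rel_I Q) U) =
        m_op (pts P) (subb P) (rel_I P) (box (pts P) T U)) \<and>
     (\<forall>U\<in>S_fam (pts Q) (subb Q).
        box (pts P) T (m_op (pts Q) (subb Q) (rel_D Q) U) =
        m_op (pts P) (subb P) (rel_D P) (box (pts P) T U))}"

definition star_comp ::
  "'x set \<Rightarrow> 'z set \<Rightarrow> 'z set set \<Rightarrow> ('y \<times> 'z) set \<Rightarrow> ('x \<times> 'y) set \<Rightarrow> ('x \<times> 'z) set" where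
  "star_comp X1 X3 K3 T R =
     {(x, z) \<in> X1 \<times> X3. \<forall>U\<in>S_fam X3 K3. (R O T) `` {x} \<subseteq> U \<longrightarrow> z \<in> U}"

definition dual_spec_order :: "'x set \<Rightarrow> 'x set set \<Rightarrow> ('x \<times> 'x) set" where
  "dual_spec_order X K = {(x, y) \<in> X \<times> X. y \<in> topology_generated_by K closure_of {x}}"

text \<open>Size conventions. HOL has no type of all sets, so the objects of both categories live on
  fixed types \<open>'a\<close> and \<open>'x\<close>, and \<open>small\<close> says which subsets of \<open>'a\<close> carry objects. Dualising sends
  a semilattice \<open>A\<close> to a space with \<open>|A|\<close> subbasic sets but up to \<open>2^|A|\<close> points, and a space
  to an algebra of size \<open>|K|\<close>; hence smallness of a space is measured by its subbase \<open>K\<close>. With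
  \<open>small = (\<lambda>_. True)\<close> and \<open>'x = 'a set\<close> the SLatas are all those on \<open>'a\<close>. If \<open>small\<close>
  is closed under power sets and smaller cardinalities, as in a Grothendieck universe, a space is small in this sense iff
  its set of points is; see \<open>small_subbase_iff_small_points\<close> below.\<close>

definition SLataSp :: "('a set \<Rightarrow> bool) \<Rightarrow> ('x slata_space, ('x \<times> 'x) set) category" where
  "SLataSp small = \<lparr>Obj = {P. is_slata_space P \<and> (\<exists>A. small A \<and> subb P \<approx> A)},
     Hom = slata_relations,
     Idm = (\<lambda>P. dual_spec_order (pts P) (subb P)),
     Comp = (\<lambda>P Q R g f. star_comp (pts P) (pts R) (subb R) g f)\<rparr>"

lemma S_space_points_inj:
  assumes "S_space X K" "x \<in> X" "y \<in> X" "{U \<in> K. x \<in> U} = {U \<in> K. y \<in> U}"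
  shows "x = y"
proof (rule ccontr)
  assume "x \<noteq> y"
  moreover have "t0_space (topology_generated_by K)" "X = \<Union>K"
    using assms(1) by (auto simp: S_space_def)
  ultimately obtain V where V: "openin (topology_generated_by K) V" "\<not> (x \<in> V \<longleftrightarrow> y \<in> V)"
    using assms(2,3) unfolding t0_space_def by (metis topology_generated_by_topspace)
  have "generate_topology_on K V"
    using V(1) by (simp add: openin_topology_generated_by)
  then have "x \<in> V \<longleftrightarrow> y \<in> V"
  proof induction
    case (Basis s)
    then show ?case using assms(4) by blast
  qed auto
  then show False using V(2) by blast
qed

lemma small_subbase_iff_small_points:
  fixes small :: "'x set \<Rightarrow> bool"
  assumes "S_space X K"
    and small_lepoll: "\<And>A B. small B \<Longrightarrow> A \<lesssim> B \<Longrightarrow> small A"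
    and small_Pow: "\<And>A. small A \<Longrightarrow> \<exists>B. small B \<and> Pow A \<approx> B"
  shows "(\<exists>A. small A \<and> K \<approx> A) \<longleftrightarrow> small X"
proof
  assume "\<exists>A. small A \<and> K \<approx> A"
  then obtain A B where A: "small A" "K \<approx> A" and B: "small B" "Pow A \<approx> B"
    using small_Pow by blast
  have "inj_on (\<lambda>x. {U \<in> K. x \<in> U}) X"
    using S_space_points_inj[OF assms(1)] by (auto simp: inj_on_def)
  moreover have "(\<lambda>x. {U \<in> K. x \<in> U}) ` X \<subseteq> Pow K"
    by auto
  ultimately have "X \<lesssim> Pow K"
    unfolding lepoll_def by blast
  also have "Pow K \<lesssim> Pow A"
    using A(2) bij_betw_Pow unfolding eqpoll_def lepoll_def bij_betw_def by blast
  also have "Pow A \<lesssim> B"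
    using B(2) eqpoll_imp_lepoll by blast
  finally show "small X"
    using small_lepoll B(1) by blast
next
  assume "small X"
  then obtain B where B: "small B" "Pow X \<approx> B"
    using small_Pow by blast
  have "K \<subseteq> Pow X"
    using assms(1) by (auto simp: S_space_def)
  then have "K \<lesssim> B"
    using B(2) by (meson eqpoll_imp_lepoll lepoll_trans subset_imp_lepoll)
  then obtain A where "A \<subseteq> B" "K \<approx> A"
    unfolding lepoll_def eqpoll_def bij_betw_def by blast
  then show "\<exists>A. small A \<and> K \<approx> A"
    using B(1) small_lepoll subset_imp_lepoll by blast
qed

end

theory Submission
  imports Defs
begin

text \<open>
  A space is recovered from the semilattice of its subbasic closed sets, and an SLata from its
  irreducible filters. The functor behind the equivalence sends an SLata-space to the SLata \<open>S(X)\<close> of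
  its subbasic closed sets, with intersection as meet and with \<open>m\<^sub>I\<close>, \<open>m\<^sub>D\<close> as unary operators, and
  sends a relation \<open>T\<close> to its box operator \<open>\<box>\<^sub>T\<close>, which goes backwards. It suffices that this functor is fully faithful and
  essentially surjective (\<open>fully_faithful_essentially_surjective_imp_equivalent\<close>).

  \<^emph>\<open>The functor is defined.\<close> The two point-wise axioms relating \<open>I\<close> and \<open>D\<close> are the inclusions
  \<open>U \<subseteq> m\<^sub>D (m\<^sub>I U)\<close> and \<open>m\<^sub>I (m\<^sub>D U) \<subseteq> U\<close> (\<open>slata_space_iff_unit_counit\<close>), so they say exactly that
  \<open>m\<^sub>I\<close> is left adjoint to \<open>m\<^sub>D\<close>.

  \<^emph>\<open>Fully faithful\<close> (\<open>bij_betw_coded_box\<close>). The closure condition on a meet-relation says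
  \<open>T(x) = \<Inter>{U. x \<in> \<box>\<^sub>T U}\<close>, so \<open>T\<close> is determined by \<open>\<box>\<^sub>T\<close>; this also reduces the category laws for
  relations to equations between operators. Conversely a homomorphism \<open>h\<close> defines a relation by
  \<open>T(x) = \<Inter>{U. x \<in> h U}\<close>, and \<open>\<box>\<^sub>T = h\<close> because compactness of the subbasic open sets turns
  \<open>T(x) \<subseteq> U\<close> into an inclusion of a finite intersection, which \<open>h\<close> respects.

  \<^emph>\<open>Essentially surjective\<close> (\<open>dual_functor_essentially_surjective\<close>). The dual space of an SLata \<open>A\<close> has the
  irreducible filters as points and the sets \<open>\<beta>(a)\<close> of irreducible filters containing \<open>a\<close> as subbasic
  closed sets. The third axiom of an \<open>S\<close>-space is irreducibility of the points. Compactness, the axiom on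
  \<open>Y\<close>-families and the fact that \<open>\<beta>\<close> is an order embedding come from one consequence of Zorn's lemma
  (\<open>irreducible_filter_separation\<close>): a filter \<open>F\<close> and a nonempty set that is disjoint from \<open>F\<close> and
  directed modulo \<open>F\<close> are separated by an irreducible filter. A monotone operator on \<open>A\<close>
  is represented by a multirelation (\<open>m_op_multirel\<close>), so the adjunction passes to the space.
\<close>

section \<open>Equivalences from fully faithful, essentially surjective functors\<close>

lemma Idm_in_Hom: "is_category C \<Longrightarrow> X \<in> Obj C \<Longrightarrow> Idm C X \<in> Hom C X X"
  by (simp add: is_category_def)

lemma Comp_in_Hom:
  "\<lbrakk>is_category C; X \<in> Obj C; Y \<in> Obj C; Z \<in> Obj C; f \<in> Hom C X Y; g \<in> Hom C Y Z\<rbrakk>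
    \<Longrightarrow> Comp C X Y Z g f \<in> Hom C X Z"
  unfolding is_category_def by blast

lemma Comp_Idm_right:
  "\<lbrakk>is_category C; X \<in> Obj C; Y \<in> Obj C; f \<in> Hom C X Y\<rbrakk> \<Longrightarrow> Comp C X X Y f (Idm C X) = f"
  unfolding is_category_def by blast

lemma Comp_Idm_left:
  "\<lbrakk>is_category C; X \<in> Obj C; Y \<in> Obj C; f \<in> Hom C X Y\<rbrakk> \<Longrightarrow> Comp C X Y Y (Idm C Y) f = f"
  unfolding is_category_def by blast

lemma Comp_assoc:
  "\<lbrakk>is_category C; W \<in> Obj C; X \<in> Obj C; Y \<in> Obj C; Z \<in> Obj C;
    f \<in> Hom C W X; g \<in> Hom C X Y; h \<in> Hom C Y Z\<rbrakk>
    \<Longrightarrow> Comp C W Y Z h (Comp C W X Y g f) = Comp C W X Z (Comp C X Y Z h g) f"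
  unfolding is_category_def by blast

lemma opposite_simps:
  "Obj (opposite C) = Obj C" "Hom (opposite C) X Y = Hom C Y X"
  "Idm (opposite C) = Idm C" "Comp (opposite C) X Y Z g f = Comp C Z Y X f g"
  by (simp_all add: opposite_def)

lemma is_category_opposite: "is_category C \<Longrightarrow> is_category (opposite C)"
  unfolding is_category_def opposite_def by simp

text \<open>The quasi-inverse \<open>G\<close> picks for each object \<open>Y\<close> of \<open>D\<close> an object with an isomorphism
  \<open>e Y : F (G Y) \<rightarrow> Y\<close>, and sends a morphism \<open>g\<close> to the unique lift along \<open>F\<close> of its conjugate by \<open>e\<close>. Since
  \<open>F\<close> is faithful, equations between morphisms of \<open>C\<close> are checked after applying \<open>F\<close>.\<close>

lemma fully_faithful_essentially_surjective_imp_equivalent: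
  fixes C :: "('o1, 'm1) category" and D :: "('o2, 'm2) category"
  assumes C: "is_category C" and D: "is_category D" and F: "is_functor C D F"
    and ff: "\<And>X Y. X \<in> Obj C \<Longrightarrow> Y \<in> Obj C \<Longrightarrow>
      bij_betw (MMap F X Y) (Hom C X Y) (Hom D (OMap F X) (OMap F Y))"
    and es: "\<And>Y. Y \<in> Obj D \<Longrightarrow> \<exists>X\<in>Obj C. \<exists>f. is_iso D (OMap F X) Y f"
  shows "equivalent_categories C D"
proof -
  let ?F = "OMap F"
  note Dc = Comp_in_Hom[OF D] and Dr = Comp_Idm_right[OF D] and Dl = Comp_Idm_left[OF D]
    and Da = Comp_assoc[OF D] and Di = Idm_in_Hom[OF D]
    and Cc = Comp_in_Hom[OF C] and Ci = Idm_in_Hom[OF C]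
  have Fo: "?F X \<in> Obj D" if "X \<in> Obj C" for X
    using F that by (simp add: is_functor_def)
  have Fm: "MMap F X Y f \<in> Hom D (?F X) (?F Y)" if "X \<in> Obj C" "Y \<in> Obj C" "f \<in> Hom C X Y" for X Y f
    using F that by (simp add: is_functor_def)
  have Fi: "MMap F X X (Idm C X) = Idm D (?F X)" if "X \<in> Obj C" for X
    using F that by (simp add: is_functor_def)
  have Fc: "MMap F X Z (Comp C X Y Z g f) = Comp D (?F X) (?F Y) (?F Z) (MMap F Y Z g) (MMap F X Y f)"
    if "X \<in> Obj C" "Y \<in> Obj C" "Z \<in> Obj C" "f \<in> Hom C X Y" "g \<in> Hom C Y Z" for X Y Z f g
    using F that unfolding is_functor_def by blast
  have faithful: "f = f'" if "X \<in> Obj C" "Y \<in> Obj C" "f \<in> Hom C X Y" "f' \<in> Hom C X Y"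
    "MMap F X Y f = MMap F X Y f'" for X Y f f'
    using bij_betw_imp_inj_on[OF ff[OF that(1,2)]] that(3-5) by (simp add: inj_on_eq_iff)
  define lift where "lift X Y = inv_into (Hom C X Y) (MMap F X Y)" for X Y
  have lift_in: "lift X Y g \<in> Hom C X Y"
    if "X \<in> Obj C" "Y \<in> Obj C" "g \<in> Hom D (?F X) (?F Y)" for X Y g
    unfolding lift_def using ff[OF that(1,2)] that(3) by (metis bij_betw_imp_surj_on inv_into_into)
  have F_lift: "MMap F X Y (lift X Y g) = g"
    if "X \<in> Obj C" "Y \<in> Obj C" "g \<in> Hom D (?F X) (?F Y)" for X Y g
    unfolding lift_def using ff[OF that(1,2)] that(3) by (simp add: bij_betw_inv_into_right)
  obtain G e where G_e: "\<And>Y. Y \<in> Obj D \<Longrightarrow> G Y \<in> Obj C \<and> is_iso D (?F (G Y)) Y (e Y)"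
    using es by metis
  then have G: "G Y \<in> Obj C" if "Y \<in> Obj D" for Y
    using that by blast
  have e: "e Y \<in> Hom D (?F (G Y)) Y" if "Y \<in> Obj D" for Y
    using G_e[OF that] by (simp add: is_iso_def)
  obtain e' where e'_all: "\<And>Y. Y \<in> Obj D \<Longrightarrow> e' Y \<in> Hom D Y (?F (G Y))
      \<and> Comp D (?F (G Y)) Y (?F (G Y)) (e' Y) (e Y) = Idm D (?F (G Y))
      \<and> Comp D Y (?F (G Y)) Y (e Y) (e' Y) = Idm D Y"
    using G_e unfolding is_iso_def by metis
  then have e': "e' Y \<in> Hom D Y (?F (G Y))"
    and e'e: "Comp D (?F (G Y)) Y (?F (G Y)) (e' Y) (e Y) = Idm D (?F (G Y))"
    and ee': "Comp D Y (?F (G Y)) Y (e Y) (e' Y) = Idm D Y" if "Y \<in> Obj D" for Y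
    using that by blast+
  have FG: "?F (G Y) \<in> Obj D" if "Y \<in> Obj D" for Y
    using that by (simp add: Fo G)
  define conj where "conj Y Z g =
    Comp D (?F (G Y)) Z (?F (G Z)) (e' Z) (Comp D (?F (G Y)) Y Z g (e Y))" for Y Z g
  have conj_in: "conj Y Z g \<in> Hom D (?F (G Y)) (?F (G Z))"
    if "Y \<in> Obj D" "Z \<in> Obj D" "g \<in> Hom D Y Z" for Y Z g
    unfolding conj_def using that by (intro Dc e e' FG)
  \<comment> \<open>Conjugation by the chosen isomorphisms slides past them; both naturality squares are instances.\<close>
  have e_conj: "Comp D (?F (G Y)) (?F (G Z)) Z (e Z) (conj Y Z g) = Comp D (?F (G Y)) Y Z g (e Y)"
    if "Y \<in> Obj D" "Z \<in> Obj D" "g \<in> Hom D Y Z" for Y Z g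
  proof -
    have m: "Comp D (?F (G Y)) Y Z g (e Y) \<in> Hom D (?F (G Y)) Z"
      using that by (intro Dc e FG)
    show ?thesis
      unfolding conj_def
      using Da[OF FG[OF that(1)] that(2) FG[OF that(2)] that(2) m e'[OF that(2)] e[OF that(2)]]
        ee'[OF that(2)] Dl[OF FG[OF that(1)] that(2) m] by simp
  qed
  have conj_e': "Comp D Y (?F (G Y)) (?F (G Z)) (conj Y Z g) (e' Y) = Comp D Y Z (?F (G Z)) (e' Z) g"
    if "Y \<in> Obj D" "Z \<in> Obj D" "g \<in> Hom D Y Z" for Y Z g
  proof -
    have m: "Comp D (?F (G Y)) Y Z g (e Y) \<in> Hom D (?F (G Y)) Z"
      using that by (intro Dc e FG)
    have "Comp D Y (?F (G Y)) (?F (G Z)) (conj Y Z g) (e' Y) =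
        Comp D Y Z (?F (G Z)) (e' Z) (Comp D Y (?F (G Y)) Z (Comp D (?F (G Y)) Y Z g (e Y)) (e' Y))"
      unfolding conj_def
      using Da[OF that(1) FG[OF that(1)] that(2) FG[OF that(2)] e'[OF that(1)] m e'[OF that(2)]] by simp
    also have "Comp D Y (?F (G Y)) Z (Comp D (?F (G Y)) Y Z g (e Y)) (e' Y) = g"
      using Da[OF that(1) FG[OF that(1)] that(1,2) e'[OF that(1)] e[OF that(1)] that(3)]
        ee'[OF that(1)] Dr[OF that] by simp
    finally show ?thesis .
  qed
  have conj_id: "conj Y Y (Idm D Y) = Idm D (?F (G Y))" if "Y \<in> Obj D" for Y
    unfolding conj_def using that by (simp add: Dl FG e e'e)
  have conj_comp: "conj X Z (Comp D X Y Z h g) =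
      Comp D (?F (G X)) (?F (G Y)) (?F (G Z)) (conj Y Z h) (conj X Y g)"
    if "X \<in> Obj D" "Y \<in> Obj D" "Z \<in> Obj D" "g \<in> Hom D X Y" "h \<in> Hom D Y Z" for X Y Z g h
  proof -
    have m: "Comp D (?F (G Y)) Y Z h (e Y) \<in> Hom D (?F (G Y)) Z"
      using that by (intro Dc e FG)
    have "Comp D (?F (G X)) (?F (G Y)) (?F (G Z)) (conj Y Z h) (conj X Y g) =
       Comp D (?F (G X)) Z (?F (G Z)) (e' Z)
         (Comp D (?F (G X)) (?F (G Y)) Z (Comp D (?F (G Y)) Y Z h (e Y)) (conj X Y g))"
      unfolding conj_def[of Y Z] using conj_in that
      by (intro Da[symmetric] FG m e') auto
    also have "Comp D (?F (G X)) (?F (G Y)) Z (Comp D (?F (G Y)) Y Z h (e Y)) (conj X Y g) =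
       Comp D (?F (G X)) Y Z h (Comp D (?F (G X)) (?F (G Y)) Y (e Y) (conj X Y g))"
      using conj_in that by (intro Da[symmetric] FG e) auto
    also have "\<dots> = Comp D (?F (G X)) X Z (Comp D X Y Z h g) (e X)"
      using that by (simp add: e_conj) (intro Da FG e)
    finally show ?thesis
      by (simp add: conj_def)
  qed
  define Gf :: "('o2, 'm2, 'o1, 'm1) functr" where
    "Gf = \<lparr>OMap = G, MMap = (\<lambda>Y Z g. lift (G Y) (G Z) (conj Y Z g))\<rparr>"
  have F_Gf: "MMap F (G Y) (G Z) (lift (G Y) (G Z) (conj Y Z g)) = conj Y Z g"
    and Gf_in: "lift (G Y) (G Z) (conj Y Z g) \<in> Hom C (G Y) (G Z)"
    if "Y \<in> Obj D" "Z \<in> Obj D" "g \<in> Hom D Y Z" for Y Z g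
    using that by (auto intro!: F_lift lift_in conj_in G)
  have Gfun: "is_functor D C Gf"
    unfolding is_functor_def
  proof (intro conjI ballI)
    fix Y assume Y: "Y \<in> Obj D"
    show "OMap Gf Y \<in> Obj C"
      by (simp add: Gf_def G Y)
    show "MMap Gf Y Y (Idm D Y) = Idm C (OMap Gf Y)"
      unfolding Gf_def functr.simps
      by (rule faithful[OF G[OF Y] G[OF Y]]) (simp_all add: Y lift_in F_lift Di Ci Fi G FG conj_id)
  next
    fix X Y f assume "X \<in> Obj D" "Y \<in> Obj D" "f \<in> Hom D X Y"
    then show "MMap Gf X Y f \<in> Hom C (OMap Gf X) (OMap Gf Y)"
      by (simp add: Gf_def Gf_in)
  next
    fix X Y Z f g assume *: "X \<in> Obj D" "Y \<in> Obj D" "Z \<in> Obj D" "f \<in> Hom D X Y" "g \<in> Hom D Y Z"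
    then have c: "Comp D X Y Z g f \<in> Hom D X Z"
      by (intro Dc)
    show "MMap Gf X Z (Comp D X Y Z g f) =
        Comp C (OMap Gf X) (OMap Gf Y) (OMap Gf Z) (MMap Gf Y Z g) (MMap Gf X Y f)"
      unfolding Gf_def functr.simps
    proof (rule faithful[OF G[OF *(1)] G[OF *(3)]])
      show "Comp C (G X) (G Y) (G Z) (lift (G Y) (G Z) (conj Y Z g)) (lift (G X) (G Y) (conj X Y f))
          \<in> Hom C (G X) (G Z)"
        using * by (intro Cc Gf_in G)
      show "MMap F (G X) (G Z) (lift (G X) (G Z) (conj X Z (Comp D X Y Z g f))) =
          MMap F (G X) (G Z) (Comp C (G X) (G Y) (G Z)
            (lift (G Y) (G Z) (conj Y Z g)) (lift (G X) (G Y) (conj X Y f)))"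
        using * c by (simp add: Fc G Gf_in F_Gf flip: conj_comp)
    qed (use * c Gf_in in auto)
  qed
  define \<eta> where "\<eta> X = lift X (G (?F X)) (e' (?F X))" for X
  have \<eta>_in: "\<eta> X \<in> Hom C X (G (?F X))" and F\<eta>: "MMap F X (G (?F X)) (\<eta> X) = e' (?F X)"
    if "X \<in> Obj C" for X
    unfolding \<eta>_def using that by (auto intro!: lift_in F_lift e' G Fo)
  have "is_iso C X (G (?F X)) (\<eta> X)" if X: "X \<in> Obj C" for X
    unfolding is_iso_def
  proof (intro conjI bexI)
    let ?i = "lift (G (?F X)) X (e (?F X))"
    note FX = Fo[OF X] and GX = G[OF Fo[OF X]]
    show i: "?i \<in> Hom C (G (?F X)) X" "\<eta> X \<in> Hom C X (G (?F X))"
      using X by (auto intro!: lift_in G Fo e \<eta>_in)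
    have Fi': "MMap F (G (?F X)) X ?i = e (?F X)"
      using X by (auto intro!: F_lift G Fo e)
    show "Comp C X (G (?F X)) X ?i (\<eta> X) = Idm C X"
      by (rule faithful[OF X X]) (use i X GX FX in \<open>simp_all add: Cc Ci Fc Fi Fi' F\<eta> ee'\<close>)
    show "Comp C (G (?F X)) X (G (?F X)) (\<eta> X) ?i = Idm C (G (?F X))"
      by (rule faithful[OF GX GX]) (use i X GX FX in \<open>simp_all add: Cc Ci Fc Fi Fi' F\<eta> e'e\<close>)
  qed
  moreover have "Comp C X Y (G (?F Y)) (\<eta> Y) f =
      Comp C X (G (?F X)) (G (?F Y)) (MMap Gf (?F X) (?F Y) (MMap F X Y f)) (\<eta> X)"
    if *: "X \<in> Obj C" "Y \<in> Obj C" "f \<in> Hom C X Y" for X Y f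
  proof -
    have l: "lift (G (?F X)) (G (?F Y)) (conj (?F X) (?F Y) (MMap F X Y f)) \<in> Hom C (G (?F X)) (G (?F Y))"
      using * by (intro Gf_in Fo Fm)
    show ?thesis
      unfolding Gf_def functr.simps
      by (rule faithful[of X "G (?F Y)"])
        (use * l in \<open>simp_all add: Cc Fc F\<eta> \<eta>_in G Fo Fm F_Gf conj_e'\<close>)
  qed
  ultimately have "natural_iso C C id_functor (comp_functor Gf F) \<eta>"
    unfolding natural_iso_def id_functor_def comp_functor_def by (simp add: Gf_def)
  moreover have "natural_iso D D (comp_functor F Gf) id_functor e"
    unfolding natural_iso_def id_functor_def comp_functor_def Gf_def
    using G_e by (simp add: F_Gf e_conj)
  ultimately show ?thesis
    unfolding equivalent_categories_def using C D F Gfun by blast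
qed


section \<open>The semilattice of subbasic closed sets\<close>

lemma S_spaceD:
  assumes "S_space X K"
  shows S_space_points_Union: "X = \<Union>K"
    and S_space_compactin: "\<And>U. U \<in> K \<Longrightarrow> compactin (topology_generated_by K) U"
    and S_space_Un: "\<And>U V. U \<in> K \<Longrightarrow> V \<in> K \<Longrightarrow> U \<union> V \<in> K"
    and S_space_empty: "{} \<in> K"
  using assms unfolding S_space_def by (elim conjE; simp)+

lemma S_fam_subset: "U \<in> S_fam X K \<Longrightarrow> U \<subseteq> X"
  by (auto simp: S_fam_def)

lemma S_fam_top:
  assumes "S_space X K" shows "X \<in> S_fam X K"
  using S_space_empty[OF assms] unfolding S_fam_def by blast

lemma S_fam_Int:
  assumes "S_space X K" "U \<in> S_fam X K" "V \<in> S_fam X K"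
  shows "U \<inter> V \<in> S_fam X K"
proof -
  obtain U' V' where "U = X - U'" "V = X - V'" "U' \<in> K" "V' \<in> K"
    using assms(2,3) by (auto simp: S_fam_def)
  then show ?thesis
    using S_space_Un[OF assms(1)] unfolding S_fam_def by blast
qed

lemma S_fam_compl:
  assumes "S_space X K" "U \<in> S_fam X K" shows "X - U \<in> K"
proof -
  obtain U' where "U = X - U'" "U' \<in> K"
    using assms(2) by (auto simp: S_fam_def)
  moreover from this have "X - U = U'"
    using S_space_points_Union[OF assms(1)] by blast
  ultimately show ?thesis by simp
qed

lemma S_fam_eqpoll_subbase:
  assumes "S_space X K" shows "S_fam X K \<approx> K"
proof -
  have "bij_betw (\<lambda>U. X - U) (S_fam X K) K"
  proof (rule bij_betw_byWitness[where f' = "\<lambda>U. X - U"])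
    show "\<forall>U\<in>S_fam X K. X - (X - U) = U"
      by (auto dest: S_fam_subset)
    show "\<forall>U\<in>K. X - (X - U) = U"
      using S_space_points_Union[OF assms] by blast
    show "(\<lambda>U. X - U) ` S_fam X K \<subseteq> K"
      using S_fam_compl[OF assms] by blast
    show "(\<lambda>U. X - U) ` K \<subseteq> S_fam X K"
      unfolding S_fam_def by blast
  qed
  then show ?thesis unfolding eqpoll_def by blast
qed

lemma S_fam_finite_Inter:
  assumes "S_space X K" "finite \<V>" "\<V> \<subseteq> S_fam X K"
  shows "X \<inter> \<Inter>\<V> \<in> S_fam X K"
  using assms(2,3)
proof induction
  case empty
  then show ?case using S_fam_top[OF assms(1)] by simp
next
  case (insert V \<V>)
  then have "X \<inter> \<Inter>(insert V \<V>) = V \<inter> (X \<inter> \<Inter>\<V>)"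
    by auto
  then show ?case
    using insert S_fam_Int[OF assms(1)] by simp
qed

text \<open>This is compactness of the members of \<open>K\<close> read through complements.\<close>

lemma S_fam_compactness:
  assumes X: "S_space X K" and "\<V> \<subseteq> S_fam X K" "U \<in> S_fam X K" "X \<inter> \<Inter>\<V> \<subseteq> U"
  obtains \<W> where "finite \<W>" "\<W> \<subseteq> \<V>" "X \<inter> \<Inter>\<W> \<subseteq> U"
proof -
  have "compactin (topology_generated_by K) (X - U)"
    using S_space_compactin[OF X S_fam_compl[OF X assms(3)]] .
  moreover have "\<forall>O'\<in>(\<lambda>V. X - V) ` \<V>. openin (topology_generated_by K) O'"
    using S_fam_compl[OF X] assms(2) by (auto intro!: topology_generated_by_Basis)
  moreover have "X - U \<subseteq> \<Union>((\<lambda>V. X - V) ` \<V>)"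
    using assms(4) by blast
  ultimately obtain \<F> where "finite \<F>" "\<F> \<subseteq> (\<lambda>V. X - V) ` \<V>" "X - U \<subseteq> \<Union>\<F>"
    unfolding compactin_def by meson
  then obtain \<W> where "finite \<W>" "\<W> \<subseteq> \<V>" "\<F> = (\<lambda>V. X - V) ` \<W>"
    by (meson finite_subset_image)
  with \<open>X - U \<subseteq> \<Union>\<F>\<close> show ?thesis
    using that[of \<W>] by auto
qed


section \<open>The adjunction of an SLata-space\<close>

lemma mS_spaceD:
  assumes "mS_space X K R"
  shows mS_space_S: "S_space X K"
    and mS_space_subset: "R \<subseteq> X \<times> Z_fam X K"
    and mS_space_closed: "U \<in> S_fam X K \<Longrightarrow> m_op X K R U \<in> S_fam X K"
  using assms unfolding mS_space_def by (elim conjE; simp)+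

lemma m_op_mono: "U \<subseteq> V \<Longrightarrow> m_op X K R U \<subseteq> m_op X K R V"
  unfolding m_op_def L_fam_def by blast

text \<open>The two point-wise axioms of an SLata-space are the inclusions \<open>U \<subseteq> m\<^sub>D (m\<^sub>I U)\<close> and
  \<open>m\<^sub>I (m\<^sub>D U) \<subseteq> U\<close>, that is, unit and counit of an adjunction between monotone operators.\<close>

lemma slata_space_iff_unit_counit:
  assumes "mS_space (pts P) (subb P) (rel_I P)" "mS_space (pts P) (subb P) (rel_D P)"
  defines "S \<equiv> S_fam (pts P) (subb P)"
    and "m\<^sub>I \<equiv> m_op (pts P) (subb P) (rel_I P)" and "m\<^sub>D \<equiv> m_op (pts P) (subb P) (rel_D P)"
  shows "is_slata_space P \<longleftrightarrow> (\<forall>U\<in>S. U \<subseteq> m\<^sub>D (m\<^sub>I U)) \<and> (\<forall>U\<in>S. m\<^sub>I (m\<^sub>D U) \<subseteq> U)"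
proof -
  let ?X = "pts P" and ?K = "subb P" and ?I = "rel_I P" and ?D = "rel_D P"
  have I: "?I \<subseteq> ?X \<times> Z_fam ?X ?K" and D: "?D \<subseteq> ?X \<times> Z_fam ?X ?K"
    using assms(1,2) by (simp_all add: mS_spaceD)
  have Z: "Z \<subseteq> ?X" if "Z \<in> Z_fam ?X ?K" for Z
    using that unfolding Z_fam_def by blast
  have mm: "x \<in> m_op ?X ?K R (m_op ?X ?K R' U) \<longleftrightarrow>
      x \<in> ?X \<and> (\<forall>Z\<in>R `` {x}. \<exists>w\<in>Z. R' `` {w} \<subseteq> L_fam ?X ?K U)"
    if R: "R \<subseteq> ?X \<times> Z_fam ?X ?K" for R R' U x
  proof -
    have "Z \<in> L_fam ?X ?K (m_op ?X ?K R' U) \<longleftrightarrow> (\<exists>w\<in>Z. R' `` {w} \<subseteq> L_fam ?X ?K U)"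
      if "Z \<in> R `` {x}" for Z
    proof -
      have "Z \<in> Z_fam ?X ?K" using that R by blast
      then have "Z \<in> L_fam ?X ?K V \<longleftrightarrow> Z \<inter> V \<noteq> {}" for V
        by (simp add: L_fam_def)
      moreover have "Z \<subseteq> ?X"
        using Z \<open>Z \<in> Z_fam ?X ?K\<close> .
      ultimately show ?thesis unfolding m_op_def by auto
    qed
    then show ?thesis unfolding m_op_def[of _ _ R] by blast
  qed
  have "U \<subseteq> m\<^sub>D (m\<^sub>I U) \<longleftrightarrow> (\<forall>x\<in>U. \<forall>Z\<in>?D `` {x}. \<exists>w\<in>Z. ?I `` {w} \<subseteq> L_fam ?X ?K U)"
    if "U \<in> S" for U
  proof -
    have "U \<subseteq> ?X"
      using S_fam_subset that unfolding S_def .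
    then show ?thesis
      unfolding m\<^sub>D_def m\<^sub>I_def subset_eq[of U] using mm[OF D] by (meson subsetD)
  qed
  moreover have "m\<^sub>I (m\<^sub>D U) \<subseteq> U \<longleftrightarrow>
      (\<forall>x\<in>?X. (\<forall>Z\<in>?I `` {x}. \<exists>y\<in>Z. ?D `` {y} \<subseteq> L_fam ?X ?K U) \<longrightarrow> x \<in> U)" for U
    unfolding m\<^sub>D_def m\<^sub>I_def subset_eq[of _ U] using mm[OF I] by blast
  ultimately show ?thesis
    using assms(1,2) unfolding is_slata_space_def Let_def S_def by simp
qed

lemma slata_spaceD:
  assumes "is_slata_space P"
  shows slata_space_I: "mS_space (pts P) (subb P) (rel_I P)"
    and slata_space_D: "mS_space (pts P) (subb P) (rel_D P)"
  using assms by (simp_all add: is_slata_space_def Let_def)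

lemma slata_space_S: "is_slata_space P \<Longrightarrow> S_space (pts P) (subb P)"
  by (rule mS_space_S[OF slata_space_I])

lemma slata_space_adjunction:
  assumes P: "is_slata_space P" and UV: "U \<in> S_fam (pts P) (subb P)" "V \<in> S_fam (pts P) (subb P)"
  shows "m_op (pts P) (subb P) (rel_I P) U \<subseteq> V \<longleftrightarrow> U \<subseteq> m_op (pts P) (subb P) (rel_D P) V"
proof -
  note uc = slata_space_iff_unit_counit[OF slata_space_I[OF P] slata_space_D[OF P], THEN iffD1, OF P]
  show ?thesis
    using uc UV m_op_mono by (meson order_trans)
qed


section \<open>Meet-relations as semilattice homomorphisms\<close>

lemma box_Int: "box X T (U \<inter> V) = box X T U \<inter> box X T V"
  unfolding box_def by blast

lemma meet_relation_box_top: "meet_relation X1 K1 X2 K2 T \<Longrightarrow> box X1 T X2 = X1"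
  unfolding meet_relation_def box_def by blast

lemma meet_relation_closed:
  "meet_relation X1 K1 X2 K2 T \<Longrightarrow> U \<in> S_fam X2 K2 \<Longrightarrow> box X1 T U \<in> S_fam X1 K1"
  unfolding meet_relation_def by blast

text \<open>\<open>h\<close> is thought of as a box operator, and \<open>T(x) = \<Inter>{U. x \<in> h U}\<close> is the largest relation with
  \<open>h U \<subseteq> \<box>\<^sub>T U\<close> for all \<open>U\<close>.\<close>

definition relation_of_box :: "'x set \<Rightarrow> 'y set \<Rightarrow> 'y set set \<Rightarrow> ('y set \<Rightarrow> 'x set) \<Rightarrow> ('x \<times> 'y) set"
  where "relation_of_box X1 X2 S2 h = {(x, y) \<in> X1 \<times> X2. \<forall>U\<in>S2. x \<in> h U \<longrightarrow> y \<in> U}"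

lemma relation_of_box_box:
  assumes "meet_relation X1 K1 X2 K2 T"
  shows "relation_of_box X1 X2 (S_fam X2 K2) (box X1 T) = T"
proof -
  have sub: "T \<subseteq> X1 \<times> X2"
    and eq: "\<And>x. x \<in> X1 \<Longrightarrow> T `` {x} = X2 \<inter> \<Inter>{U \<in> S_fam X2 K2. T `` {x} \<subseteq> U}"
    using assms unfolding meet_relation_def by blast+
  have "(x, y) \<in> T \<longleftrightarrow> (x, y) \<in> relation_of_box X1 X2 (S_fam X2 K2) (box X1 T)" for x y
  proof (cases "x \<in> X1")
    case True
    then have "(x, y) \<in> T \<longleftrightarrow> y \<in> X2 \<inter> \<Inter>{U \<in> S_fam X2 K2. T `` {x} \<subseteq> U}"
      using eq[OF True] by (metis Image_singleton_iff)
    with True show ?thesis unfolding relation_of_box_def box_def by blast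
  qed (use sub in \<open>auto simp: relation_of_box_def\<close>)
  then show ?thesis by auto
qed

text \<open>A point \<open>x\<close> whose related points all lie in \<open>U\<close> satisfies \<open>\<Inter>{V. x \<in> h V} \<subseteq> U\<close>.
  Compactness makes the intersection finite, and then \<open>h\<close> preserves it.\<close>

lemma box_relation_of_box:
  assumes X1: "S_space X1 K1" and X2: "S_space X2 K2"
    and h_in: "\<And>U. U \<in> S_fam X2 K2 \<Longrightarrow> h U \<in> S_fam X1 K1"
    and h_top: "h X2 = X1"
    and h_Int: "\<And>U V. U \<in> S_fam X2 K2 \<Longrightarrow> V \<in> S_fam X2 K2 \<Longrightarrow> h (U \<inter> V) = h U \<inter> h V"
    and U: "U \<in> S_fam X2 K2"
  shows "box X1 (relation_of_box X1 X2 (S_fam X2 K2) h) U = h U"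
proof
  show "h U \<subseteq> box X1 (relation_of_box X1 X2 (S_fam X2 K2) h) U"
    using S_fam_subset[OF h_in[OF U]] U unfolding box_def relation_of_box_def by blast
next
  have mono: "h V \<subseteq> h W" if "V \<in> S_fam X2 K2" "W \<in> S_fam X2 K2" "V \<subseteq> W" for V W
    using h_Int[OF that(1,2)] that(3) by (simp add: Int_absorb2 le_iff_inf)
  show "box X1 (relation_of_box X1 X2 (S_fam X2 K2) h) U \<subseteq> h U"
  proof
    fix x assume "x \<in> box X1 (relation_of_box X1 X2 (S_fam X2 K2) h) U"
    then have x: "x \<in> X1" and sub: "X2 \<inter> \<Inter>{V \<in> S_fam X2 K2. x \<in> h V} \<subseteq> U"
      unfolding box_def relation_of_box_def by blast+
    obtain \<W> where \<W>: "finite \<W>" "\<W> \<subseteq> {V \<in> S_fam X2 K2. x \<in> h V}" "X2 \<inter> \<Inter>\<W> \<subseteq> U"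
      using S_fam_compactness[OF X2 _ U sub] by blast
    from \<W>(1,2) have "x \<in> h (X2 \<inter> \<Inter>\<W>)"
    proof induction
      case empty
      then show ?case using x h_top by simp
    next
      case (insert V \<W>)
      then have V: "V \<in> S_fam X2 K2" "X2 \<inter> \<Inter>\<W> \<in> S_fam X2 K2"
        using S_fam_finite_Inter[OF X2, of \<W>] by auto
      have "X2 \<inter> \<Inter>(insert V \<W>) = V \<inter> (X2 \<inter> \<Inter>\<W>)"
        by auto
      with insert show ?case using h_Int[OF V] by auto
    qed
    moreover have "X2 \<inter> \<Inter>\<W> \<in> S_fam X2 K2"
      using \<W>(1,2) by (intro S_fam_finite_Inter[OF X2]) auto
    ultimately show "x \<in> h U"
      using mono[OF _ U \<W>(3)] by blast
  qed
qed

lemma meet_relation_relation_of_box: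
  assumes X1: "S_space X1 K1" and X2: "S_space X2 K2"
    and h_in: "\<And>U. U \<in> S_fam X2 K2 \<Longrightarrow> h U \<in> S_fam X1 K1"
    and h_top: "h X2 = X1"
    and h_Int: "\<And>U V. U \<in> S_fam X2 K2 \<Longrightarrow> V \<in> S_fam X2 K2 \<Longrightarrow> h (U \<inter> V) = h U \<inter> h V"
  shows "meet_relation X1 K1 X2 K2 (relation_of_box X1 X2 (S_fam X2 K2) h)"
    (is "meet_relation _ _ _ _ ?T")
  unfolding meet_relation_def
proof (intro conjI ballI)
  have b: "box X1 ?T U = h U" if "U \<in> S_fam X2 K2" for U
    using box_relation_of_box[of X1 K1 X2 K2 h U] assms that by blast
  show "?T \<subseteq> X1 \<times> X2"
    unfolding relation_of_box_def by blast
  show "box X1 ?T U \<in> S_fam X1 K1" if "U \<in> S_fam X2 K2" for U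
    using b h_in that by simp
  show "?T `` {x} = X2 \<inter> \<Inter>{U \<in> S_fam X2 K2. ?T `` {x} \<subseteq> U}" if "x \<in> X1" for x
    using that by (auto simp: relation_of_box_def)
qed

text \<open>Meet-relations are determined by their boxes, so identities between meet-relations, such as
  the laws of a category, can be checked on boxes, where composition is composition of functions.\<close>

lemma meet_relation_eqI:
  assumes "meet_relation X1 K1 X2 K2 T" "meet_relation X1 K1 X2 K2 T'"
    and "\<And>U. U \<in> S_fam X2 K2 \<Longrightarrow> box X1 T U = box X1 T' U"
  shows "T = T'"
proof -
  have "relation_of_box X1 X2 (S_fam X2 K2) (box X1 T) = relation_of_box X1 X2 (S_fam X2 K2) (box X1 T')"
    using assms(3) unfolding relation_of_box_def by auto
  then show ?thesis
    using relation_of_box_box[OF assms(1)] relation_of_box_box[OF assms(2)] by simp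
qed

text \<open>The relation \<open>star_comp\<close> is the smallest one of closed form that contains the ordinary composite; passing to it
  does not change which subbasic closed sets contain the images of a point.\<close>

lemma box_star_comp:
  assumes "R \<subseteq> X1 \<times> X2" "T \<subseteq> X2 \<times> X3" "U \<in> S_fam X3 K3"
  shows "box X1 (star_comp X1 X3 K3 T R) U = box X1 R (box X2 T U)"
proof -
  have "R O T \<subseteq> X1 \<times> X3"
    using assms by blast
  then have "R O T \<subseteq> star_comp X1 X3 K3 T R"
    unfolding star_comp_def by blast
  moreover have "star_comp X1 X3 K3 T R `` {x} \<subseteq> U" if "(R O T) `` {x} \<subseteq> U" for x
    using that assms(3) unfolding star_comp_def by blast
  moreover have "(R O T) `` {x} \<subseteq> U \<longleftrightarrow> R `` {x} \<subseteq> box X2 T U" for x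
    using assms(1) unfolding box_def by blast
  ultimately show ?thesis
    unfolding box_def[of X1] by blast
qed

lemma meet_relation_star_comp:
  assumes "meet_relation X1 K1 X2 K2 R" "meet_relation X2 K2 X3 K3 T"
  shows "meet_relation X1 K1 X3 K3 (star_comp X1 X3 K3 T R)"
  unfolding meet_relation_def
proof (intro conjI ballI)
  have R: "R \<subseteq> X1 \<times> X2" and T: "T \<subseteq> X2 \<times> X3"
    using assms unfolding meet_relation_def by blast+
  show "star_comp X1 X3 K3 T R \<subseteq> X1 \<times> X3"
    unfolding star_comp_def by blast
  show "box X1 (star_comp X1 X3 K3 T R) U \<in> S_fam X1 K1" if "U \<in> S_fam X3 K3" for U
    using that assms by (simp add: box_star_comp[OF R T] meet_relation_closed)
  show "star_comp X1 X3 K3 T R `` {x} =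
      X3 \<inter> \<Inter>{U \<in> S_fam X3 K3. star_comp X1 X3 K3 T R `` {x} \<subseteq> U}" if "x \<in> X1" for x
    using that by (auto simp: star_comp_def)
qed

lemma in_closure_of_singleton_generated:
  "y \<in> topology_generated_by K closure_of {x} \<longleftrightarrow> y \<in> \<Union>K \<and> (\<forall>U\<in>K. y \<in> U \<longrightarrow> x \<in> U)"
proof -
  have "x \<in> V" if "generate_topology_on K V" "y \<in> V" "\<forall>U\<in>K. y \<in> U \<longrightarrow> x \<in> U" for V
    using that by induction auto
  then show ?thesis
    unfolding in_closure_of openin_topology_generated_by_iff
    by (auto intro: generate_topology_on.Basis)
qed

text \<open>The relation belonging to the identity operator, which makes it the identity of the category.\<close>

lemma dual_spec_order_eq:
  assumes "S_space X K"
  shows "dual_spec_order X K = relation_of_box X X (S_fam X K) (\<lambda>U. U)"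
proof -
  have "(\<forall>U\<in>K. y \<in> U \<longrightarrow> x \<in> U) \<longleftrightarrow> (\<forall>U\<in>S_fam X K. x \<in> U \<longrightarrow> y \<in> U)" if "x \<in> X" "y \<in> X" for x y
    using that unfolding S_fam_def by blast
  then show ?thesis
    using S_space_points_Union[OF assms]
    unfolding dual_spec_order_def relation_of_box_def in_closure_of_singleton_generated by auto
qed

lemma
  assumes "S_space X K"
  shows meet_relation_dual_spec_order: "meet_relation X K X K (dual_spec_order X K)"
    and box_dual_spec_order: "U \<in> S_fam X K \<Longrightarrow> box X (dual_spec_order X K) U = U"
  unfolding dual_spec_order_eq[OF assms]
  using meet_relation_relation_of_box[OF assms assms, of "\<lambda>U. U"]
    box_relation_of_box[OF assms assms, of "\<lambda>U. U"] by auto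


section \<open>The category of SLata-spaces\<close>

lemma SLataSp_simps:
  "Obj (SLataSp small) = {P. is_slata_space P \<and> (\<exists>A. small A \<and> subb P \<approx> A)}"
  "Hom (SLataSp small) = slata_relations"
  "Idm (SLataSp small) P = dual_spec_order (pts P) (subb P)"
  "Comp (SLataSp small) P Q R g f = star_comp (pts P) (pts R) (subb R) g f"
  by (simp_all add: SLataSp_def)

lemma slata_relations_meet:
  "T \<in> slata_relations P Q \<Longrightarrow> meet_relation (pts P) (subb P) (pts Q) (subb Q) T"
  by (simp add: slata_relations_def)

lemma slata_relations_eqI:
  assumes "T \<in> slata_relations P Q" "T' \<in> slata_relations P Q"
    and "\<And>U. U \<in> S_fam (pts Q) (subb Q) \<Longrightarrow> box (pts P) T U = box (pts P) T' U"
  shows "T = T'"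
  using assms by (intro meet_relation_eqI[OF slata_relations_meet slata_relations_meet])

lemma box_comp_slata_relations:
  assumes "R \<in> slata_relations P Q" "T \<in> slata_relations Q W" "U \<in> S_fam (pts W) (subb W)"
  shows "box (pts P) (star_comp (pts P) (pts W) (subb W) T R) U = box (pts P) R (box (pts Q) T U)"
  using assms by (intro box_star_comp) (auto simp: slata_relations_def meet_relation_def)

lemma star_comp_slata_relations:
  assumes W: "is_slata_space W"
    and R: "R \<in> slata_relations P Q" and T: "T \<in> slata_relations Q W"
  shows "star_comp (pts P) (pts W) (subb W) T R \<in> slata_relations P W"
  unfolding slata_relations_def
proof (intro CollectI conjI ballI)
  show "meet_relation (pts P) (subb P) (pts W) (subb W) (star_comp (pts P) (pts W) (subb W) T R)"
    using meet_relation_star_comp[OF slata_relations_meet[OF R] slata_relations_meet[OF T]] .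
  fix U assume U: "U \<in> S_fam (pts W) (subb W)"
  then have "box (pts Q) T U \<in> S_fam (pts Q) (subb Q)"
    using T unfolding slata_relations_def meet_relation_def by blast
  moreover note mS_space_closed[OF slata_space_I[OF W] U] mS_space_closed[OF slata_space_D[OF W] U]
  ultimately show
    "box (pts P) (star_comp (pts P) (pts W) (subb W) T R) (m_op (pts W) (subb W) (rel_I W) U) =
      m_op (pts P) (subb P) (rel_I P) (box (pts P) (star_comp (pts P) (pts W) (subb W) T R) U)"
    "box (pts P) (star_comp (pts P) (pts W) (subb W) T R) (m_op (pts W) (subb W) (rel_D W) U) =
      m_op (pts P) (subb P) (rel_D P) (box (pts P) (star_comp (pts P) (pts W) (subb W) T R) U)"
    using R T U by (simp_all add: box_comp_slata_relations[OF R T]) (simp_all add: slata_relations_def)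
qed

lemma dual_spec_order_slata_relation:
  assumes "is_slata_space P"
  shows "dual_spec_order (pts P) (subb P) \<in> slata_relations P P"
  using assms slata_spaceD[OF assms] slata_space_S[OF assms]
  by (simp add: slata_relations_def meet_relation_dual_spec_order box_dual_spec_order mS_space_closed)

lemma slata_relation_box_closed:
  "T \<in> slata_relations P Q \<Longrightarrow> U \<in> S_fam (pts Q) (subb Q) \<Longrightarrow> box (pts P) T U \<in> S_fam (pts P) (subb P)"
  using meet_relation_closed slata_relations_meet by blast

lemma is_category_SLataSp: "is_category (SLataSp small)"
  unfolding is_category_def SLataSp_simps
proof (intro conjI ballI)
  fix P Q T assume "P \<in> {P. is_slata_space P \<and> (\<exists>A. small A \<and> subb P \<approx> A)}"
    "Q \<in> {P. is_slata_space P \<and> (\<exists>A. small A \<and> subb P \<approx> A)}" and T: "T \<in> slata_relations P Q"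
  then have P: "is_slata_space P" and Q: "is_slata_space Q"
    by auto
  note idP = dual_spec_order_slata_relation[OF P] and idQ = dual_spec_order_slata_relation[OF Q]
  show "star_comp (pts P) (pts Q) (subb Q) T (dual_spec_order (pts P) (subb P)) = T"
    by (rule slata_relations_eqI[OF star_comp_slata_relations[OF Q idP T] T])
      (simp add: box_comp_slata_relations[OF idP T] box_dual_spec_order[OF slata_space_S[OF P]]
        slata_relation_box_closed[OF T])
  show "star_comp (pts P) (pts Q) (subb Q) (dual_spec_order (pts Q) (subb Q)) T = T"
    by (rule slata_relations_eqI[OF star_comp_slata_relations[OF Q T idQ] T])
      (simp add: box_comp_slata_relations[OF T idQ] box_dual_spec_order[OF slata_space_S[OF Q]])
next
  fix O' P Q W f g h assume "P \<in> {P. is_slata_space P \<and> (\<exists>A. small A \<and> subb P \<approx> A)}"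
    "Q \<in> {P. is_slata_space P \<and> (\<exists>A. small A \<and> subb P \<approx> A)}"
    "W \<in> {P. is_slata_space P \<and> (\<exists>A. small A \<and> subb P \<approx> A)}"
    and f: "f \<in> slata_relations O' P" and g: "g \<in> slata_relations P Q" and h: "h \<in> slata_relations Q W"
  then have P: "is_slata_space P" and Q: "is_slata_space Q" and W: "is_slata_space W"
    by auto
  note gf = star_comp_slata_relations[OF Q f g] and hg = star_comp_slata_relations[OF W g h]
  show "star_comp (pts O') (pts W) (subb W) h (star_comp (pts O') (pts Q) (subb Q) g f) =
      star_comp (pts O') (pts W) (subb W) (star_comp (pts P) (pts W) (subb W) h g) f"
    by (rule slata_relations_eqI[OF star_comp_slata_relations[OF W gf h] star_comp_slata_relations[OF W f hg]])
      (simp add: box_comp_slata_relations[OF gf h] box_comp_slata_relations[OF f hg]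
        box_comp_slata_relations[OF f g] box_comp_slata_relations[OF g h] slata_relation_box_closed[OF h])
qed (auto intro: dual_spec_order_slata_relation star_comp_slata_relations)


section \<open>The category of SLatas\<close>

lemma SLata_simps:
  "Obj (SLata small) = {A. is_slata A \<and> small (carrier A)}"
  "Hom (SLata small) = slata_hom"
  "Idm (SLata small) A = (\<lambda>x\<in>carrier A. x)"
  "Comp (SLata small) A B C g f = compose (carrier A) g f"
  by (simp_all add: SLata_def)

lemma slata_homI:
  assumes "\<And>a. a \<in> carrier A \<Longrightarrow> h a \<in> carrier B"
    and "\<And>a b. a \<in> carrier A \<Longrightarrow> b \<in> carrier A \<Longrightarrow> h (a \<otimes>\<^bsub>A\<^esub> b) = h a \<otimes>\<^bsub>B\<^esub> h b"
    and "h \<one>\<^bsub>A\<^esub> = \<one>\<^bsub>B\<^esub>"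
    and "\<And>a. a \<in> carrier A \<Longrightarrow> h (op_i A a) = op_i B (h a)"
    and "\<And>a. a \<in> carrier A \<Longrightarrow> h (op_d A a) = op_d B (h a)"
    and "h \<in> extensional (carrier A)"
  shows "h \<in> slata_hom A B"
  using assms by (simp add: slata_hom_def hom_def)

lemma slata_homD:
  assumes "h \<in> slata_hom A B"
  shows slata_hom_closed: "a \<in> carrier A \<Longrightarrow> h a \<in> carrier B"
    and slata_hom_mult: "a \<in> carrier A \<Longrightarrow> b \<in> carrier A \<Longrightarrow> h (a \<otimes>\<^bsub>A\<^esub> b) = h a \<otimes>\<^bsub>B\<^esub> h b"
    and slata_hom_one: "h \<one>\<^bsub>A\<^esub> = \<one>\<^bsub>B\<^esub>"
    and slata_hom_i: "a \<in> carrier A \<Longrightarrow> h (op_i A a) = op_i B (h a)"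
    and slata_hom_d: "a \<in> carrier A \<Longrightarrow> h (op_d A a) = op_d B (h a)"
    and slata_hom_extensional: "h \<in> extensional (carrier A)"
  using assms by (auto simp: slata_hom_def hom_def)

lemma slataD:
  assumes "is_slata A"
  shows slata_mult: "a \<in> carrier A \<Longrightarrow> b \<in> carrier A \<Longrightarrow> a \<otimes>\<^bsub>A\<^esub> b \<in> carrier A"
    and slata_one: "\<one>\<^bsub>A\<^esub> \<in> carrier A"
    and slata_i: "a \<in> carrier A \<Longrightarrow> op_i A a \<in> carrier A"
    and slata_d: "a \<in> carrier A \<Longrightarrow> op_d A a \<in> carrier A"
proof -
  have "comm_monoid A" and id: "op_i A \<in> carrier A \<rightarrow> carrier A" "op_d A \<in> carrier A \<rightarrow> carrier A"
    using assms by (simp_all add: is_slata_def semilattice_def)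
  then interpret comm_monoid A by simp
  show "a \<in> carrier A \<Longrightarrow> b \<in> carrier A \<Longrightarrow> a \<otimes>\<^bsub>A\<^esub> b \<in> carrier A" "\<one>\<^bsub>A\<^esub> \<in> carrier A"
    by simp_all
  show "a \<in> carrier A \<Longrightarrow> op_i A a \<in> carrier A" "a \<in> carrier A \<Longrightarrow> op_d A a \<in> carrier A"
    using id by (simp_all add: Pi_iff)
qed

lemma slata_hom_id: "is_slata A \<Longrightarrow> (\<lambda>x\<in>carrier A. x) \<in> slata_hom A A"
  by (intro slata_homI) (simp_all add: slataD)

lemma slata_hom_compose:
  assumes "is_slata A" "f \<in> slata_hom A B" "g \<in> slata_hom B C"
  shows "compose (carrier A) g f \<in> slata_hom A C"
  by (intro slata_homI) (simp_all add: compose_def slataD[OF assms(1)] slata_homD[OF assms(2)] slata_homD[OF assms(3)])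

lemma is_category_SLata: "is_category (SLata small)"
  unfolding is_category_def SLata_simps
proof (intro conjI ballI)
  fix A B f assume f: "f \<in> slata_hom A B"
  show "compose (carrier A) f (\<lambda>x\<in>carrier A. x) = f" "compose (carrier A) (\<lambda>x\<in>carrier B. x) f = f"
    using slata_hom_closed[OF f] slata_hom_extensional[OF f]
    by (auto simp: fun_eq_iff compose_def extensional_def restrict_def)
next
  fix W A B C f g h
  assume f: "f \<in> slata_hom W A"
  show "compose (carrier W) h (compose (carrier W) g f) = compose (carrier W) (compose (carrier A) h g) f"
    using slata_hom_closed[OF f] by (auto simp: fun_eq_iff compose_def)
qed (auto intro: slata_hom_id slata_hom_compose)


section \<open>The SLata of closed sets of an SLata-space\<close>

abbreviation subbasic_closed :: "'x slata_space \<Rightarrow> 'x set set" where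
  "subbasic_closed P \<equiv> S_fam (pts P) (subb P)"

abbreviation m\<^sub>I :: "'x slata_space \<Rightarrow> 'x set \<Rightarrow> 'x set" where
  "m\<^sub>I P \<equiv> m_op (pts P) (subb P) (rel_I P)"

abbreviation m\<^sub>D :: "'x slata_space \<Rightarrow> 'x set \<Rightarrow> 'x set" where
  "m\<^sub>D P \<equiv> m_op (pts P) (subb P) (rel_D P)"

lemma
  assumes "is_slata_space P"
  shows subbasic_closed_top: "pts P \<in> subbasic_closed P"
    and subbasic_closed_Int: "U \<in> subbasic_closed P \<Longrightarrow> V \<in> subbasic_closed P \<Longrightarrow> U \<inter> V \<in> subbasic_closed P"
    and subbasic_closed_m\<^sub>I: "U \<in> subbasic_closed P \<Longrightarrow> m\<^sub>I P U \<in> subbasic_closed P"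
    and subbasic_closed_m\<^sub>D: "U \<in> subbasic_closed P \<Longrightarrow> m\<^sub>D P U \<in> subbasic_closed P"
  using S_fam_top[OF slata_space_S[OF assms]] S_fam_Int[OF slata_space_S[OF assms]]
    mS_space_closed[OF slata_space_I[OF assms]] mS_space_closed[OF slata_space_D[OF assms]] by auto

text \<open>The subbasic closed sets form an SLata of sets, whereas the objects of the algebraic category
  live on the type \<open>'a\<close>. A \<^emph>\<open>coding\<close> is an isomorphism between the two.\<close>

locale coding =
  fixes P :: "'x slata_space" and A :: "'a slata" and \<phi> :: "'x set \<Rightarrow> 'a"
  assumes space: "is_slata_space P"
    and bij: "bij_betw \<phi> (subbasic_closed P) (carrier A)"
    and code_top: "\<phi> (pts P) = \<one>\<^bsub>A\<^esub>"
    and code_Int: "\<And>U V. U \<in> subbasic_closed P \<Longrightarrow> V \<in> subbasic_closed P \<Longrightarrow> \<phi> (U \<inter> V) = \<phi> U \<otimes>\<^bsub>A\<^esub> \<phi> V"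
    and code_i: "\<And>U. U \<in> subbasic_closed P \<Longrightarrow> \<phi> (m\<^sub>I P U) = op_i A (\<phi> U)"
    and code_d: "\<And>U. U \<in> subbasic_closed P \<Longrightarrow> \<phi> (m\<^sub>D P U) = op_d A (\<phi> U)"
begin

definition decode :: "'a \<Rightarrow> 'x set" where
  "decode = inv_into (subbasic_closed P) \<phi>"

lemmas closed = subbasic_closed_top[OF space] subbasic_closed_Int[OF space] subbasic_closed_m\<^sub>I[OF space]
  subbasic_closed_m\<^sub>D[OF space]

lemma code_in: "U \<in> subbasic_closed P \<Longrightarrow> \<phi> U \<in> carrier A"
  using bij bij_betwE by blast

lemma decode_in: "a \<in> carrier A \<Longrightarrow> decode a \<in> subbasic_closed P"
  unfolding decode_def using bij by (metis bij_betw_imp_surj_on inv_into_into)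

lemma code_decode: "a \<in> carrier A \<Longrightarrow> \<phi> (decode a) = a"
  unfolding decode_def using bij by (simp add: bij_betw_inv_into_right)

lemma decode_code: "U \<in> subbasic_closed P \<Longrightarrow> decode (\<phi> U) = U"
  unfolding decode_def using bij by (simp add: bij_betw_inv_into_left)

lemma decode_eqI: "U \<in> subbasic_closed P \<Longrightarrow> \<phi> U = a \<Longrightarrow> decode a = U"
  using decode_code by blast

lemma one_in: "\<one>\<^bsub>A\<^esub> \<in> carrier A"
  using code_in[OF closed(1)] code_top by simp

lemma mult_in: "a \<in> carrier A \<Longrightarrow> b \<in> carrier A \<Longrightarrow> a \<otimes>\<^bsub>A\<^esub> b \<in> carrier A"
  using code_in[OF closed(2)] code_Int code_decode decode_in by metis

lemma i_in: "a \<in> carrier A \<Longrightarrow> op_i A a \<in> carrier A"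
  using code_in[OF closed(3)] code_i code_decode decode_in by metis

lemma d_in: "a \<in> carrier A \<Longrightarrow> op_d A a \<in> carrier A"
  using code_in[OF closed(4)] code_d code_decode decode_in by metis

lemma decode_one: "decode \<one>\<^bsub>A\<^esub> = pts P"
  by (intro decode_eqI closed code_top)

lemma decode_mult: "a \<in> carrier A \<Longrightarrow> b \<in> carrier A \<Longrightarrow> decode (a \<otimes>\<^bsub>A\<^esub> b) = decode a \<inter> decode b"
  by (intro decode_eqI closed) (simp_all add: decode_in code_Int code_decode)

lemma decode_i: "a \<in> carrier A \<Longrightarrow> decode (op_i A a) = m\<^sub>I P (decode a)"
  by (intro decode_eqI closed) (simp_all add: decode_in code_i code_decode)

lemma decode_d: "a \<in> carrier A \<Longrightarrow> decode (op_d A a) = m\<^sub>D P (decode a)"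
  by (intro decode_eqI closed) (simp_all add: decode_in code_d code_decode)

lemma decode_inj: "a \<in> carrier A \<Longrightarrow> b \<in> carrier A \<Longrightarrow> decode a = decode b \<Longrightarrow> a = b"
  using code_decode by metis

lemma sl_le_iff: "a \<in> carrier A \<Longrightarrow> b \<in> carrier A \<Longrightarrow> sl_le A a b \<longleftrightarrow> decode a \<subseteq> decode b"
  unfolding sl_le_def by (metis decode_inj decode_mult le_iff_inf mult_in)

lemma is_slata: "is_slata A"
proof -
  have "comm_monoid A"
  proof (rule comm_monoidI)
    fix a b c assume abc: "a \<in> carrier A" "b \<in> carrier A" "c \<in> carrier A"
    show "a \<otimes>\<^bsub>A\<^esub> b \<otimes>\<^bsub>A\<^esub> c = a \<otimes>\<^bsub>A\<^esub> (b \<otimes>\<^bsub>A\<^esub> c)"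
      by (rule decode_inj) (use abc in \<open>simp_all add: mult_in decode_mult Int_assoc\<close>)
  next
    fix a b assume ab: "a \<in> carrier A" "b \<in> carrier A"
    show "a \<otimes>\<^bsub>A\<^esub> b = b \<otimes>\<^bsub>A\<^esub> a"
      by (rule decode_inj) (use ab in \<open>auto simp: mult_in decode_mult\<close>)
  next
    fix a assume a: "a \<in> carrier A"
    show "\<one>\<^bsub>A\<^esub> \<otimes>\<^bsub>A\<^esub> a = a"
      by (rule decode_inj)
        (use a S_fam_subset[OF decode_in[OF a]] in \<open>auto simp: one_in mult_in decode_mult decode_one\<close>)
  qed (simp_all add: one_in mult_in)
  moreover have "a \<otimes>\<^bsub>A\<^esub> a = a" if "a \<in> carrier A" for a
    by (rule decode_inj) (use that in \<open>simp_all add: mult_in decode_mult\<close>)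
  ultimately show ?thesis
    unfolding is_slata_def semilattice_def
    by (simp add: i_in d_in sl_le_iff decode_i decode_d slata_space_adjunction[OF space] decode_in)
qed

end

definition subbasic_closed_slata :: "'x slata_space \<Rightarrow> ('x set \<Rightarrow> 'a) \<Rightarrow> 'a slata" where
  "subbasic_closed_slata P \<phi> = (let \<psi> = inv_into (subbasic_closed P) \<phi> in
     \<lparr>carrier = \<phi> ` subbasic_closed P, mult = \<lambda>a b. \<phi> (\<psi> a \<inter> \<psi> b), one = \<phi> (pts P),
      op_i = \<lambda>a. \<phi> (m\<^sub>I P (\<psi> a)), op_d = \<lambda>a. \<phi> (m\<^sub>D P (\<psi> a))\<rparr>)"

lemma carrier_subbasic_closed_slata: "carrier (subbasic_closed_slata P \<phi>) = \<phi> ` subbasic_closed P"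
  by (simp add: subbasic_closed_slata_def Let_def)

lemma coding_subbasic_closed_slata:
  assumes "is_slata_space P" "inj_on \<phi> (subbasic_closed P)"
  shows "coding P (subbasic_closed_slata P \<phi>) \<phi>"
  using assms by unfold_locales (simp_all add: subbasic_closed_slata_def Let_def inj_on_imp_bij_betw)

text \<open>In codes, an SLata-relation from \<open>P\<close> to \<open>Q\<close> acts as its box operator, which goes backwards.\<close>

definition coded_box ::
  "'x slata_space \<Rightarrow> ('x set \<Rightarrow> 'a) \<Rightarrow> 'x slata_space \<Rightarrow> ('x set \<Rightarrow> 'a) \<Rightarrow> ('x \<times> 'x) set \<Rightarrow> 'a \<Rightarrow> 'a" where
  "coded_box P \<phi> Q \<psi> T = (\<lambda>b\<in>\<psi> ` subbasic_closed Q. \<phi> (box (pts P) T (inv_into (subbasic_closed Q) \<psi> b)))"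

text \<open>Injectivity is the fact that a meet-relation is determined by its box; surjectivity uses the
  relation defined by the decoded homomorphism \<open>h\<close>.\<close>

lemma bij_betw_coded_box:
  fixes P Q :: "'x slata_space" and A B :: "'a slata"
  assumes "coding P A \<phi>" "coding Q B \<psi>"
  shows "bij_betw (coded_box P \<phi> Q \<psi>) (slata_relations P Q) (slata_hom B A)"
proof -
  interpret P: coding P A \<phi> by fact
  interpret Q: coding Q B \<psi> by fact
  have img: "\<psi> ` subbasic_closed Q = carrier B"
    using Q.bij by (rule bij_betw_imp_surj_on)
  have eq: "coded_box P \<phi> Q \<psi> T = (\<lambda>b\<in>carrier B. \<phi> (box (pts P) T (Q.decode b)))" for T
    unfolding coded_box_def img Q.decode_def ..
  note PS = slata_space_S[OF P.space] and QS = slata_space_S[OF Q.space]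
  have hom: "coded_box P \<phi> Q \<psi> T \<in> slata_hom B A" if T: "T \<in> slata_relations P Q" for T
  proof -
    have c: "U \<in> subbasic_closed Q \<Longrightarrow> box (pts P) T U \<in> subbasic_closed P" for U
      by (rule slata_relation_box_closed[OF T])
    have "box (pts P) T (m\<^sub>I Q U) = m\<^sub>I P (box (pts P) T U)"
      "box (pts P) T (m\<^sub>D Q U) = m\<^sub>D P (box (pts P) T U)" if "U \<in> subbasic_closed Q" for U
      using T that by (simp_all add: slata_relations_def)
    then show ?thesis
      unfolding eq
      by (intro slata_homI)
        (simp_all add: c P.code_in Q.decode_in Q.one_in Q.mult_in Q.i_in Q.d_in Q.decode_one Q.decode_mult
          Q.decode_i Q.decode_d box_Int P.code_Int P.code_top P.code_i P.code_d
          meet_relation_box_top[OF slata_relations_meet[OF T]])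
  qed
  have inj: "T = T'" if T: "T \<in> slata_relations P Q" "T' \<in> slata_relations P Q"
    and TT: "coded_box P \<phi> Q \<psi> T = coded_box P \<phi> Q \<psi> T'" for T T'
  proof (rule slata_relations_eqI[OF T])
    fix U assume U: "U \<in> subbasic_closed Q"
    have "coded_box P \<phi> Q \<psi> T (\<psi> U) = coded_box P \<phi> Q \<psi> T' (\<psi> U)"
      using TT by simp
    then have "\<phi> (box (pts P) T U) = \<phi> (box (pts P) T' U)"
      unfolding eq using U by (simp add: Q.code_in Q.decode_code)
    then show "box (pts P) T U = box (pts P) T' U"
      using P.decode_code slata_relation_box_closed T U by metis
  qed
  have surj: "\<exists>T\<in>slata_relations P Q. coded_box P \<phi> Q \<psi> T = g" if g: "g \<in> slata_hom B A" for g
  proof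
    define h where "h U = P.decode (g (\<psi> U))" for U
    let ?T = "relation_of_box (pts P) (pts Q) (subbasic_closed Q) h"
    note gD = slata_homD[OF g]
    have h_in: "h U \<in> subbasic_closed P" if "U \<in> subbasic_closed Q" for U
      using that by (simp add: h_def P.decode_in gD(1) Q.code_in)
    have h_top: "h (pts Q) = pts P"
      by (simp add: h_def Q.code_top gD(3) P.decode_one)
    have h_Int: "h (U \<inter> V) = h U \<inter> h V" if "U \<in> subbasic_closed Q" "V \<in> subbasic_closed Q" for U V
      using that by (simp add: h_def Q.code_Int gD(1,2) Q.code_in P.decode_mult)
    have h_I: "h (m\<^sub>I Q U) = m\<^sub>I P (h U)" and h_D: "h (m\<^sub>D Q U) = m\<^sub>D P (h U)" if "U \<in> subbasic_closed Q" for U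
      using that by (simp_all add: h_def Q.code_i Q.code_d gD(1,4,5) Q.code_in P.decode_i P.decode_d)
    have b: "box (pts P) ?T U = h U" if "U \<in> subbasic_closed Q" for U
      using box_relation_of_box[OF PS QS h_in h_top h_Int that] .
    show "?T \<in> slata_relations P Q"
      unfolding slata_relations_def
      using meet_relation_relation_of_box[OF PS QS h_in h_top h_Int]
      by (simp add: b h_I h_D Q.closed)
    show "coded_box P \<phi> Q \<psi> ?T = g"
      unfolding eq
    proof
      fix b
      show "(\<lambda>b\<in>carrier B. \<phi> (box (pts P) ?T (Q.decode b))) b = g b"
      proof (cases "b \<in> carrier B")
        case True
        then show ?thesis
          by (simp add: b[OF Q.decode_in] h_def Q.code_decode P.code_decode gD(1))
      next
        case False
        then show ?thesis
          using extensional_arb[OF gD(6)] by simp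
      qed
    qed
  qed
  show ?thesis
  proof (rule bij_betw_imageI)
    show "inj_on (coded_box P \<phi> Q \<psi>) (slata_relations P Q)"
      by (rule inj_onI) (rule inj)
    show "coded_box P \<phi> Q \<psi> ` slata_relations P Q = slata_hom B A"
    proof
      show "coded_box P \<phi> Q \<psi> ` slata_relations P Q \<subseteq> slata_hom B A"
        by (rule image_subsetI) (rule hom)
      show "slata_hom B A \<subseteq> coded_box P \<phi> Q \<psi> ` slata_relations P Q"
        using surj by (metis image_eqI subsetI)
    qed
  qed
qed

text \<open>The isomorphism decodes with one coding and encodes with the other.\<close>

lemma codings_isomorphic:
  fixes P :: "'x slata_space" and A B :: "'a slata"
  assumes "coding P A \<phi>" "coding P B \<psi>"
  shows "\<exists>f. is_iso (SLata small) A B f"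
proof -
  interpret A: coding P A \<phi> by fact
  interpret B: coding P B \<psi> by fact
  let ?f = "\<lambda>a\<in>carrier A. \<psi> (A.decode a)" and ?g = "\<lambda>b\<in>carrier B. \<phi> (B.decode b)"
  have "?f \<in> slata_hom A B"
    by (intro slata_homI)
      (simp_all add: B.code_in A.decode_in A.mult_in A.one_in A.i_in A.d_in A.decode_mult A.decode_one
        A.decode_i A.decode_d B.code_Int B.code_top B.code_i B.code_d)
  moreover have "?g \<in> slata_hom B A"
    by (intro slata_homI)
      (simp_all add: A.code_in B.decode_in B.mult_in B.one_in B.i_in B.d_in B.decode_mult B.decode_one
        B.decode_i B.decode_d A.code_Int A.code_top A.code_i A.code_d)
  moreover have "compose (carrier A) ?g ?f = (\<lambda>a\<in>carrier A. a)"
    "compose (carrier B) ?f ?g = (\<lambda>b\<in>carrier B. b)"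
    by (auto simp: fun_eq_iff compose_def A.code_in B.code_in A.decode_in B.decode_in
        A.decode_code B.decode_code A.code_decode B.code_decode)
  ultimately show ?thesis
    unfolding is_iso_def SLata_simps by blast
qed

text \<open>The functor needs a coding for each space. Smallness of the space provides one with small carrier.\<close>

definition code_of :: "('a set \<Rightarrow> bool) \<Rightarrow> 'x slata_space \<Rightarrow> 'x set \<Rightarrow> 'a" where
  "code_of small P = (SOME \<phi>. inj_on \<phi> (subbasic_closed P) \<and> small (\<phi> ` subbasic_closed P))"

definition dual_functor ::
  "('a set \<Rightarrow> bool) \<Rightarrow> ('x slata_space, ('x \<times> 'x) set, 'a slata, 'a \<Rightarrow> 'a) functr" where
  "dual_functor small = \<lparr>
     OMap = \<lambda>P. subbasic_closed_slata P (code_of small P),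
     MMap = \<lambda>Q P T. coded_box P (code_of small P) Q (code_of small Q) T\<rparr>"

lemma dual_functor_coding:
  fixes P :: "'x slata_space"
  assumes "P \<in> Obj (SLataSp small)"
  shows "coding P (OMap (dual_functor small) P) (code_of small P)"
    and "small (carrier (OMap (dual_functor small) P))"
proof -
  obtain A where P: "is_slata_space P" and A: "small A" "subb P \<approx> A"
    using assms by (auto simp: SLataSp_simps)
  then have "subbasic_closed P \<approx> A"
    using S_fam_eqpoll_subbase[OF slata_space_S[OF P]] eqpoll_trans by blast
  then obtain \<phi> where "inj_on \<phi> (subbasic_closed P) \<and> small (\<phi> ` subbasic_closed P)"
    using A(1) unfolding eqpoll_def bij_betw_def by blast
  then have "inj_on (code_of small P) (subbasic_closed P) \<and> small (code_of small P ` subbasic_closed P)"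
    unfolding code_of_def
    by (rule someI[where P = "\<lambda>\<phi>. inj_on \<phi> (subbasic_closed P) \<and> small (\<phi> ` subbasic_closed P)"])
  then show "coding P (OMap (dual_functor small) P) (code_of small P)"
    "small (carrier (OMap (dual_functor small) P))"
    using coding_subbasic_closed_slata[OF P, of "code_of small P"]
    by (simp_all add: dual_functor_def carrier_subbasic_closed_slata)
qed

lemma dual_functor_fully_faithful:
  assumes "P \<in> Obj (SLataSp small)" "Q \<in> Obj (SLataSp small)"
  shows "bij_betw (MMap (dual_functor small) Q P) (slata_relations P Q)
    (slata_hom (OMap (dual_functor small) Q) (OMap (dual_functor small) P))"
  using bij_betw_coded_box[OF dual_functor_coding(1)[OF assms(1)] dual_functor_coding(1)[OF assms(2)]]
  by (simp add: dual_functor_def)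

lemma is_functor_dual_functor:
  fixes small :: "'a set \<Rightarrow> bool"
  shows "is_functor (opposite (SLataSp small)) (SLata small)
    (dual_functor small :: ('x slata_space, _, _, _) functr)"
    (is "is_functor _ _ ?F")
  unfolding is_functor_def opposite_simps
proof (intro conjI ballI)
  let ?c = "code_of small"
  have eq: "MMap ?F Q P T =
      (\<lambda>b\<in>carrier (OMap ?F Q). ?c P (box (pts P) T (coding.decode Q (?c Q) b)))"
    if "Q \<in> Obj (SLataSp small)" for P Q T
    using dual_functor_coding(1)[OF that]
    by (simp add: dual_functor_def coded_box_def coding.decode_def carrier_subbasic_closed_slata)
  fix W assume W: "W \<in> Obj (SLataSp small :: ('x slata_space, ('x \<times> 'x) set) category)"
  interpret W: coding W "OMap ?F W" "?c W"
    by (rule dual_functor_coding(1)[OF W])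
  show "OMap ?F W \<in> Obj (SLata small)"
    using dual_functor_coding(2)[OF W] W.is_slata by (simp add: SLata_simps)
  show "MMap ?F W W (Idm (SLataSp small) W) = Idm (SLata small) (OMap ?F W)"
    unfolding eq[OF W] SLataSp_simps SLata_simps
    by (simp add: fun_eq_iff box_dual_spec_order[OF slata_space_S[OF W.space]] W.decode_in W.code_decode)
  fix Q assume Q: "Q \<in> Obj (SLataSp small :: ('x slata_space, ('x \<times> 'x) set) category)"
  interpret Q: coding Q "OMap ?F Q" "?c Q"
    by (rule dual_functor_coding(1)[OF Q])
  fix T assume "T \<in> Hom (SLataSp small) Q W"
  then have T: "T \<in> slata_relations Q W"
    by (simp add: SLataSp_simps)
  show "MMap ?F W Q T \<in> Hom (SLata small) (OMap ?F W) (OMap ?F Q)"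
    using bij_betwE[OF dual_functor_fully_faithful[OF Q W]] T by (simp add: SLata_simps)
next
  let ?c = "code_of small"
  fix W Q P T R
  assume W: "W \<in> Obj (SLataSp small :: ('x slata_space, ('x \<times> 'x) set) category)"
    and Q: "Q \<in> Obj (SLataSp small :: ('x slata_space, ('x \<times> 'x) set) category)"
    and P: "P \<in> Obj (SLataSp small :: ('x slata_space, ('x \<times> 'x) set) category)"
    and "T \<in> Hom (SLataSp small) Q W" "R \<in> Hom (SLataSp small) P Q"
  then have T: "T \<in> slata_relations Q W" and R: "R \<in> slata_relations P Q"
    by (simp_all add: SLataSp_simps)
  interpret W: coding W "OMap ?F W" "?c W"
    by (rule dual_functor_coding(1)[OF W])
  interpret Q: coding Q "OMap ?F Q" "?c Q"
    by (rule dual_functor_coding(1)[OF Q])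
  have eq: "MMap ?F Q P T =
      (\<lambda>b\<in>carrier (OMap ?F Q). ?c P (box (pts P) T (coding.decode Q (?c Q) b)))"
    if "Q \<in> Obj (SLataSp small)" for P Q T
    using dual_functor_coding(1)[OF that]
    by (simp add: dual_functor_def coded_box_def coding.decode_def carrier_subbasic_closed_slata)
  show "MMap ?F W P (Comp (SLataSp small) P Q W T R) =
      Comp (SLata small) (OMap ?F W) (OMap ?F Q) (OMap ?F P) (MMap ?F Q P R) (MMap ?F W Q T)"
    unfolding eq[OF W] eq[OF Q] SLataSp_simps SLata_simps
    by (auto simp: fun_eq_iff compose_def box_comp_slata_relations[OF R T] W.decode_in Q.code_in
        Q.decode_code slata_relation_box_closed[OF T])
qed


section \<open>Irreducible filters of a semilattice\<close>

locale meet_semilattice =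
  fixes A (structure)
  assumes semilattice: "semilattice A"
begin

sublocale comm_monoid A
  using semilattice by (simp add: semilattice_def)

abbreviation le (infix "\<preceq>" 50) where "a \<preceq> b \<equiv> sl_le A a b"

lemma idem: "a \<in> carrier A \<Longrightarrow> a \<otimes> a = a"
  using semilattice by (simp add: semilattice_def)

lemma le_refl: "a \<in> carrier A \<Longrightarrow> a \<preceq> a"
  by (simp add: sl_le_def idem)

lemma le_antisym: "\<lbrakk>a \<in> carrier A; b \<in> carrier A; a \<preceq> b; b \<preceq> a\<rbrakk> \<Longrightarrow> a = b"
  by (metis sl_le_def m_comm)

lemma le_trans: "\<lbrakk>a \<in> carrier A; b \<in> carrier A; c \<in> carrier A; a \<preceq> b; b \<preceq> c\<rbrakk> \<Longrightarrow> a \<preceq> c"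
  by (metis sl_le_def m_assoc)

lemma le_one: "a \<in> carrier A \<Longrightarrow> a \<preceq> \<one>"
  by (simp add: sl_le_def)

lemma meet_le1: "\<lbrakk>a \<in> carrier A; b \<in> carrier A\<rbrakk> \<Longrightarrow> a \<otimes> b \<preceq> a"
  by (metis sl_le_def m_assoc m_comm idem)

lemma meet_le2: "\<lbrakk>a \<in> carrier A; b \<in> carrier A\<rbrakk> \<Longrightarrow> a \<otimes> b \<preceq> b"
  by (metis sl_le_def m_assoc idem)

lemma le_meetI: "\<lbrakk>a \<in> carrier A; b \<in> carrier A; c \<in> carrier A; c \<preceq> a; c \<preceq> b\<rbrakk> \<Longrightarrow> c \<preceq> a \<otimes> b"
  by (metis sl_le_def m_assoc)

lemma meet_mono:
  assumes "a \<in> carrier A" "b \<in> carrier A" "c \<in> carrier A" "d \<in> carrier A" "a \<preceq> c" "b \<preceq> d"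
  shows "a \<otimes> b \<preceq> c \<otimes> d"
proof (rule le_meetI)
  show "a \<otimes> b \<preceq> c"
    by (rule le_trans[OF _ _ _ meet_le1]) (use assms in auto)
  show "a \<otimes> b \<preceq> d"
    by (rule le_trans[OF _ _ _ meet_le2]) (use assms in auto)
qed (use assms in auto)

definition is_filter :: "'a set \<Rightarrow> bool" where
  "is_filter F \<longleftrightarrow> F \<subseteq> carrier A \<and> \<one> \<in> F \<and> (\<forall>a\<in>F. \<forall>b\<in>F. a \<otimes> b \<in> F) \<and>
     (\<forall>a\<in>F. \<forall>b\<in>carrier A. a \<preceq> b \<longrightarrow> b \<in> F)"

lemma filterD:
  assumes "is_filter F"
  shows filter_subset: "F \<subseteq> carrier A"
    and filter_carrier: "a \<in> F \<Longrightarrow> a \<in> carrier A"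
    and filter_one: "\<one> \<in> F"
    and filter_meet: "a \<in> F \<Longrightarrow> b \<in> F \<Longrightarrow> a \<otimes> b \<in> F"
    and filter_up: "a \<in> F \<Longrightarrow> a \<preceq> b \<Longrightarrow> b \<in> carrier A \<Longrightarrow> b \<in> F"
  using assms unfolding is_filter_def by blast+

lemma filter_meet_iff:
  assumes "is_filter F" "a \<in> carrier A" "b \<in> carrier A"
  shows "a \<otimes> b \<in> F \<longleftrightarrow> a \<in> F \<and> b \<in> F"
  using assms filter_meet filter_up meet_le1 meet_le2 by blast

text \<open>The last clause says in terms of elements that \<open>P\<close> is not the intersection of two strictly
  larger filters: for \<open>a, b \<notin> P\<close>, the filters generated by \<open>P\<close> with \<open>a\<close> and by \<open>P\<close> with \<open>b\<close> have a common
  element \<open>d\<close> outside \<open>P\<close>. In this form it is the third axiom of an \<open>S\<close>-space.\<close>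

definition irreducible_filters :: "'a set set" where
  "irreducible_filters = {P. is_filter P \<and> P \<noteq> carrier A \<and>
     (\<forall>a\<in>carrier A - P. \<forall>b\<in>carrier A - P. \<exists>c\<in>P. \<exists>d\<in>carrier A - P. a \<otimes> c \<preceq> d \<and> b \<otimes> c \<preceq> d)}"

lemma filter_principal: "a \<in> carrier A \<Longrightarrow> is_filter {x \<in> carrier A. a \<preceq> x}"
  unfolding is_filter_def by (auto simp: le_one le_meetI intro: le_trans)

lemma filter_adjoin:
  assumes P: "is_filter P" and a: "a \<in> carrier A"
  shows "is_filter {x \<in> carrier A. \<exists>p\<in>P. a \<otimes> p \<preceq> x}" (is "is_filter ?Q")
    and "P \<subseteq> {x \<in> carrier A. \<exists>p\<in>P. a \<otimes> p \<preceq> x}" and "a \<in> {x \<in> carrier A. \<exists>p\<in>P. a \<otimes> p \<preceq> x}"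
proof -
  note c = filter_carrier[OF P]
  have "x \<otimes> y \<in> ?Q" if xy: "x \<in> ?Q" "y \<in> ?Q" for x y
  proof -
    obtain p q where pq: "p \<in> P" "q \<in> P" "a \<otimes> p \<preceq> x" "a \<otimes> q \<preceq> y"
      using xy by blast
    have [simp]: "x \<in> carrier A" "y \<in> carrier A" "p \<in> carrier A" "q \<in> carrier A"
      using xy pq c by auto
    have "a \<otimes> (p \<otimes> q) \<preceq> a \<otimes> p" "a \<otimes> (p \<otimes> q) \<preceq> a \<otimes> q"
      using a by (simp_all add: meet_mono le_refl meet_le1 meet_le2)
    then have "a \<otimes> (p \<otimes> q) \<preceq> x" "a \<otimes> (p \<otimes> q) \<preceq> y"
      using a pq by (auto intro: le_trans[of _ "a \<otimes> p"] le_trans[of _ "a \<otimes> q"])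
    then have "a \<otimes> (p \<otimes> q) \<preceq> x \<otimes> y"
      using a by (simp add: le_meetI)
    then show ?thesis
      using filter_meet[OF P pq(1,2)] by auto
  qed
  moreover have "y \<in> ?Q" if xy: "x \<in> ?Q" "y \<in> carrier A" "x \<preceq> y" for x y
  proof -
    obtain p where p: "p \<in> P" "a \<otimes> p \<preceq> x"
      using xy(1) by blast
    then have "a \<otimes> p \<preceq> y"
      using xy a c by (auto intro: le_trans[of _ x])
    then show ?thesis
      using p xy(2) by blast
  qed
  moreover have "\<one> \<in> ?Q"
    using filter_one[OF P] a by (auto intro!: bexI[of _ \<one>] le_one)
  ultimately show "is_filter ?Q"
    unfolding is_filter_def by auto
  show "P \<subseteq> ?Q"
    using meet_le2 a c by blast
  show "a \<in> ?Q"
    using meet_le1[OF a one_closed] filter_one[OF P] a by blast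
qed

lemma filter_Union_chain:
  assumes "\<C> \<noteq> {}" "subset.chain \<A> \<C>" "\<And>P. P \<in> \<A> \<Longrightarrow> is_filter P"
  shows "is_filter (\<Union>\<C>)"
proof -
  have f: "is_filter P" if "P \<in> \<C>" for P
    using assms(2,3) that unfolding subset_chain_def by blast
  have "a \<otimes> b \<in> \<Union>\<C>" if ab: "a \<in> P" "b \<in> Q" "P \<in> \<C>" "Q \<in> \<C>" for a b P Q
  proof -
    consider "P \<subseteq> Q" | "Q \<subseteq> P"
      using ab(3,4) assms(2) unfolding subset_chain_def by blast
    then show ?thesis
      using ab filter_meet[OF f] by cases blast+
  qed
  moreover have "\<one> \<in> \<Union>\<C>"
    using assms(1) filter_one[OF f] by blast
  moreover have "\<Union>\<C> \<subseteq> carrier A"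
    using filter_carrier[OF f] by blast
  moreover have "b \<in> \<Union>\<C>" if "a \<in> \<Union>\<C>" "b \<in> carrier A" "a \<preceq> b" for a b
    using that filter_up[OF f] by blast
  ultimately show ?thesis
    unfolding is_filter_def by (meson UnionE)
qed

text \<open>The condition on \<open>J\<close> says that \<open>J\<close> is directed upwards modulo \<open>F\<close>. A filter \<open>P\<close> maximal among those that
  contain \<open>F\<close> and avoid \<open>J\<close> is irreducible: adjoining any outside element to \<open>P\<close> produces an
  element of \<open>J\<close>, and any two elements of \<open>J\<close> are bounded, modulo \<open>F \<subseteq> P\<close>, by a third one, which
  is outside \<open>P\<close>.\<close>

lemma irreducible_filter_separation:
  assumes F: "is_filter F" and J: "J \<subseteq> carrier A" "J \<noteq> {}" "F \<inter> J = {}"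
    and dir: "\<And>a b. a \<in> J \<Longrightarrow> b \<in> J \<Longrightarrow> \<exists>h\<in>F. \<exists>c\<in>J. a \<otimes> h \<preceq> c \<and> b \<otimes> h \<preceq> c"
  obtains P where "P \<in> irreducible_filters" "F \<subseteq> P" "P \<inter> J = {}"
proof -
  define \<A> where "\<A> = {P. is_filter P \<and> F \<subseteq> P \<and> P \<inter> J = {}}"
  have "\<exists>P\<in>\<A>. \<forall>Q\<in>\<A>. P \<subseteq> Q \<longrightarrow> Q = P"
  proof (rule subset_Zorn_nonempty)
    show "\<A> \<noteq> {}"
      using F J unfolding \<A>_def by blast
    fix \<C> assume C: "\<C> \<noteq> {}" "subset.chain \<A> \<C>"
    then have "is_filter (\<Union>\<C>)"
      by (rule filter_Union_chain) (simp add: \<A>_def)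
    moreover have "\<C> \<subseteq> \<A>"
      using C(2) by (simp add: subset_chain_def)
    ultimately show "\<Union>\<C> \<in> \<A>"
      using C(1) unfolding \<A>_def by blast
  qed
  then obtain P where "P \<in> \<A>" and max: "\<And>Q. Q \<in> \<A> \<Longrightarrow> P \<subseteq> Q \<Longrightarrow> Q = P"
    by blast
  then have P: "is_filter P" "F \<subseteq> P" "P \<inter> J = {}"
    by (simp_all add: \<A>_def)
  \<comment> \<open>By maximality, adjoining \<open>a\<close> to \<open>P\<close> meets \<open>J\<close>.\<close>
  have reach: "\<exists>p\<in>P. \<exists>j\<in>J. a \<otimes> p \<preceq> j" if a: "a \<in> carrier A - P" for a
  proof (rule ccontr)
    let ?Q = "{x \<in> carrier A. \<exists>p\<in>P. a \<otimes> p \<preceq> x}"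
    assume "\<not> ?thesis"
    then have "?Q \<inter> J = {}"
      by blast
    then have "?Q = P"
      using max[of ?Q] filter_adjoin[OF P(1), of a] a P(2) by (auto simp: \<A>_def)
    then show False
      using filter_adjoin(3)[OF P(1), of a] a by blast
  qed
  have "\<exists>c\<in>P. \<exists>d\<in>carrier A - P. a \<otimes> c \<preceq> d \<and> b \<otimes> c \<preceq> d"
    if ab: "a \<in> carrier A - P" "b \<in> carrier A - P" for a b
  proof -
    obtain p j q k where pq: "p \<in> P" "j \<in> J" "a \<otimes> p \<preceq> j" "q \<in> P" "k \<in> J" "b \<otimes> q \<preceq> k"
      using reach ab by meson
    obtain h d where h: "h \<in> F" "d \<in> J" "j \<otimes> h \<preceq> d" "k \<otimes> h \<preceq> d"
      using dir pq by meson
    have [simp]: "a \<in> carrier A" "b \<in> carrier A" "p \<in> carrier A" "q \<in> carrier A" "h \<in> carrier A"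
      "j \<in> carrier A" "k \<in> carrier A" "d \<in> carrier A"
      using ab pq h J(1) P(2) filter_carrier[OF P(1)] by auto
    \<comment> \<open>\<open>p\<close> brings \<open>a\<close> and \<open>q\<close> brings \<open>b\<close> below elements of \<open>J\<close>, and \<open>h\<close> brings these below one \<open>d\<close>.\<close>
    let ?c = "p \<otimes> q \<otimes> h"
    have meet_le_h: "p \<otimes> (q \<otimes> h) \<preceq> p \<otimes> h"
      by (simp add: meet_mono le_refl meet_le2)
    have "a \<otimes> ?c \<preceq> (a \<otimes> p) \<otimes> h" "b \<otimes> ?c \<preceq> (b \<otimes> q) \<otimes> h"
      by (simp_all add: m_assoc meet_mono le_refl meet_le2 meet_le_h)
    moreover have "(a \<otimes> p) \<otimes> h \<preceq> j \<otimes> h" "(b \<otimes> q) \<otimes> h \<preceq> k \<otimes> h"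
      using pq by (intro meet_mono le_refl m_closed; simp)+
    ultimately have "a \<otimes> ?c \<preceq> j \<otimes> h" "b \<otimes> ?c \<preceq> k \<otimes> h"
      by (auto intro: le_trans[of _ "(a \<otimes> p) \<otimes> h"] le_trans[of _ "(b \<otimes> q) \<otimes> h"])
    then have "a \<otimes> ?c \<preceq> d" "b \<otimes> ?c \<preceq> d"
      using h(3,4) by (auto intro: le_trans[of _ "j \<otimes> h"] le_trans[of _ "k \<otimes> h"])
    moreover have "?c \<in> P"
      using pq h P(2) filter_meet[OF P(1)] by blast
    moreover have "d \<in> carrier A - P"
      using h(2) P(3) by auto
    ultimately show ?thesis by blast
  qed
  then have "P \<in> irreducible_filters"
    using P J unfolding irreducible_filters_def by blast
  then show ?thesis
    using that P by blast
qed

text \<open>Defined by generation rather than as an intersection of filters, so that induction shows that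
  each element already lies in the filter generated by finitely many elements of \<open>B\<close>, as compactness needs.\<close>

inductive_set filter_generated :: "'a set \<Rightarrow> 'a set" for B where
  one: "\<one> \<in> filter_generated B"
| base: "b \<in> B \<Longrightarrow> b \<in> carrier A \<Longrightarrow> b \<in> filter_generated B"
| meet: "a \<in> filter_generated B \<Longrightarrow> b \<in> filter_generated B \<Longrightarrow> a \<otimes> b \<in> filter_generated B"
| up: "a \<in> filter_generated B \<Longrightarrow> b \<in> carrier A \<Longrightarrow> a \<preceq> b \<Longrightarrow> b \<in> filter_generated B"

lemma filter_generated_filter: "is_filter (filter_generated B)"
proof -
  have "a \<in> carrier A" if "a \<in> filter_generated B" for a
    using that by induction auto
  then show ?thesis
    unfolding is_filter_def by (auto intro: filter_generated.intros)
qed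

lemma filter_generated_least: "is_filter F \<Longrightarrow> B \<subseteq> F \<Longrightarrow> filter_generated B \<subseteq> F"
proof
  fix x assume F: "is_filter F" "B \<subseteq> F" and "x \<in> filter_generated B"
  from this(3) show "x \<in> F"
    by induction (use F in \<open>auto dest: filterD\<close>)
qed

lemma filter_generated_subset_iff:
  assumes "is_filter F" "B \<subseteq> carrier A"
  shows "filter_generated B \<subseteq> F \<longleftrightarrow> B \<subseteq> F"
proof
  have "B \<subseteq> filter_generated B"
    using assms(2) by (auto intro: filter_generated.base)
  then show "filter_generated B \<subseteq> F \<Longrightarrow> B \<subseteq> F"
    by simp
qed (rule filter_generated_least[OF assms(1)])

lemma filter_generated_mono: "B \<subseteq> C \<Longrightarrow> filter_generated B \<subseteq> filter_generated C"
proof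
  fix x assume B: "B \<subseteq> C" and "x \<in> filter_generated B"
  from this(2) show "x \<in> filter_generated C"
    by induction (use B in \<open>auto intro: filter_generated.intros\<close>)
qed

lemma filter_generated_finite:
  assumes "a \<in> filter_generated B"
  obtains B' where "finite B'" "B' \<subseteq> B" "a \<in> filter_generated B'"
proof -
  from assms have "\<exists>B'. finite B' \<and> B' \<subseteq> B \<and> a \<in> filter_generated B'"
  proof induction
    case one
    then show ?case by (intro exI[of _ "{}"]) (auto intro: filter_generated.one)
  next
    case (base b)
    then show ?case by (intro exI[of _ "{b}"]) (auto intro: filter_generated.base)
  next
    case (meet a b)
    then obtain B1 B2 where "finite B1" "B1 \<subseteq> B" "a \<in> filter_generated B1"
      "finite B2" "B2 \<subseteq> B" "b \<in> filter_generated B2"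
      by blast
    then show ?case
      using filter_generated_mono[of B1 "B1 \<union> B2"] filter_generated_mono[of B2 "B1 \<union> B2"]
      by (intro exI[of _ "B1 \<union> B2"]) (auto intro!: filter_generated.meet)
  next
    case (up a b)
    then show ?case by (meson filter_generated.up)
  qed
  then show ?thesis
    using that by blast
qed

end


section \<open>The space of irreducible filters\<close>

text \<open>Alexander's subbase lemma for a subset: the topology that \<open>K\<close> generates on \<open>U\<close> contains all traces
  on \<open>U\<close> of sets open in the topology generated by \<open>K\<close>.\<close>

lemma compactin_topology_generated_by_subbase:
  assumes U: "U \<subseteq> \<Union>K"
    and fin: "\<And>C. C \<subseteq> K \<Longrightarrow> U \<subseteq> \<Union>C \<Longrightarrow> \<exists>C'. finite C' \<and> C' \<subseteq> C \<and> U \<subseteq> \<Union>C'"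
  shows "compactin (topology_generated_by K) U"
proof -
  let ?T = "topology (arbitrary union_of (finite intersection_of (\<lambda>x. x \<in> K) relative_to U))"
  have comp: "compactin ?T U"
    using Alexander_subbase_alt[OF U fin refl] unfolding compact_space_def by simp
  have op: "openin ?T (U \<inter> V)" if "generate_topology_on K V" for V
    using that
  proof induction
    case (Int a b)
    then have "openin ?T ((U \<inter> a) \<inter> (U \<inter> b))" by blast
    then show ?case by (simp add: Int_ac)
  next
    case (UN \<V>)
    then have "openin ?T (\<Union>V\<in>\<V>. U \<inter> V)" by blast
    then show ?case by simp
  next
    case (Basis V)
    show ?case
      unfolding openin_subbase
      by (intro arbitrary_union_of_inc relative_to_inc finite_intersection_of_inc Basis)
  qed simp
  show ?thesis
    unfolding compactin_def
  proof (intro conjI allI impI)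
    show "U \<subseteq> topspace (topology_generated_by K)"
      using U by simp
    fix \<U> assume \<U>: "(\<forall>V\<in>\<U>. openin (topology_generated_by K) V) \<and> U \<subseteq> \<Union>\<U>"
    have "\<forall>V\<in>(\<inter>) U ` \<U>. openin ?T V" "U \<subseteq> \<Union>((\<inter>) U ` \<U>)"
      using \<U> op by (auto simp: openin_topology_generated_by_iff)
    then obtain \<F> where "finite \<F>" "\<F> \<subseteq> (\<inter>) U ` \<U>" "U \<subseteq> \<Union>\<F>"
      using comp unfolding compactin_def by meson
    then obtain \<G> where "finite \<G>" "\<G> \<subseteq> \<U>" "\<F> = (\<inter>) U ` \<G>"
      by (meson finite_subset_image)
    then show "\<exists>\<F>. finite \<F> \<and> \<F> \<subseteq> \<U> \<and> U \<subseteq> \<Union>\<F>"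
      using \<open>U \<subseteq> \<Union>\<F>\<close> by (intro exI[of _ \<G>]) auto
  qed
qed

lemma is_slata_imp_meet_semilattice: "is_slata A \<Longrightarrow> meet_semilattice A"
  by (simp add: is_slata_def meet_semilattice_def)

text \<open>The points are abstract labels: \<open>F\<close> maps them bijectively to the irreducible filters. This lets
  the dual space of an algebra on \<open>'a\<close> live on any type that can accommodate its filters.\<close>

locale dual_space = meet_semilattice A for A :: "('a, 'b) monoid_scheme" (structure) +
  fixes X :: "'x set" and F :: "'x \<Rightarrow> 'a set"
  assumes points: "bij_betw F X irreducible_filters"
begin

definition \<beta> :: "'a \<Rightarrow> 'x set" where
  "\<beta> a = {x \<in> X. a \<in> F x}"

definition K :: "'x set set" where
  "K = (\<lambda>a. X - \<beta> a) ` carrier A"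

lemma F_irreducible: "x \<in> X \<Longrightarrow> F x \<in> irreducible_filters"
  using points bij_betwE by blast

lemma F_filter: "x \<in> X \<Longrightarrow> is_filter (F x)"
  using F_irreducible unfolding irreducible_filters_def by simp

lemma \<beta>_subset: "\<beta> a \<subseteq> X"
  unfolding \<beta>_def by blast

lemma S_fam_eq: "S_fam X K = \<beta> ` carrier A"
proof -
  have "X - (X - \<beta> a) = \<beta> a" for a
    using \<beta>_subset by blast
  moreover have "S_fam X K = (\<lambda>a. X - (X - \<beta> a)) ` carrier A"
    unfolding S_fam_def K_def by blast
  ultimately show ?thesis by simp
qed

lemma \<beta>_one: "\<beta> \<one> = X"
  unfolding \<beta>_def using filter_one[OF F_filter] by blast

lemma \<beta>_meet: "a \<in> carrier A \<Longrightarrow> b \<in> carrier A \<Longrightarrow> \<beta> (a \<otimes> b) = \<beta> a \<inter> \<beta> b"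
  unfolding \<beta>_def using filter_meet_iff[OF F_filter] by blast

lemma separating_point:
  assumes "is_filter G" "J \<subseteq> carrier A" "J \<noteq> {}" "G \<inter> J = {}"
    and "\<And>a b. a \<in> J \<Longrightarrow> b \<in> J \<Longrightarrow> \<exists>h\<in>G. \<exists>c\<in>J. a \<otimes> h \<preceq> c \<and> b \<otimes> h \<preceq> c"
  obtains x where "x \<in> X" "G \<subseteq> F x" "F x \<inter> J = {}"
proof -
  obtain P where P: "P \<in> irreducible_filters" "G \<subseteq> P" "P \<inter> J = {}"
    using irreducible_filter_separation[OF assms] .
  then obtain x where "x \<in> X" "F x = P"
    using points by (metis bij_betw_imp_surj_on imageE)
  with P that show ?thesis by blast
qed

text \<open>The set \<open>{a}\<close> is directed modulo any filter, with \<open>\<one>\<close> as the witness.\<close>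

lemma separating_point_element:
  assumes "is_filter G" "a \<in> carrier A" "a \<notin> G"
  obtains x where "x \<in> X" "G \<subseteq> F x" "a \<notin> F x"
proof -
  have "\<exists>h\<in>G. \<exists>c\<in>{a}. b \<otimes> h \<preceq> c \<and> b' \<otimes> h \<preceq> c" if "b \<in> {a}" "b' \<in> {a}" for b b'
    using that assms(2) filter_one[OF assms(1)] by (auto intro!: bexI[of _ \<one>] le_refl)
  then obtain x where "x \<in> X" "G \<subseteq> F x" "F x \<inter> {a} = {}"
    using separating_point[OF assms(1), of "{a}"] assms(2,3) by blast
  then show ?thesis
    using that by blast
qed

text \<open>If \<open>a \<preceq> b\<close> fails, the principal filter of \<open>a\<close> omits \<open>b\<close>, and a separating point lies in \<open>\<beta> a\<close> only.\<close>

lemma \<beta>_subset_iff: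
  assumes "a \<in> carrier A" "b \<in> carrier A"
  shows "\<beta> a \<subseteq> \<beta> b \<longleftrightarrow> a \<preceq> b"
proof
  assume "a \<preceq> b"
  then show "\<beta> a \<subseteq> \<beta> b"
    unfolding \<beta>_def using filter_up[OF F_filter] assms by blast
next
  assume sub: "\<beta> a \<subseteq> \<beta> b"
  show "a \<preceq> b"
  proof (rule ccontr)
    assume "\<not> a \<preceq> b"
    then obtain x where "x \<in> X" "{x \<in> carrier A. a \<preceq> x} \<subseteq> F x" "b \<notin> F x"
      using separating_point_element[OF filter_principal[OF assms(1)] assms(2)] by blast
    then show False
      using sub le_refl[OF assms(1)] assms(1) unfolding \<beta>_def by blast
  qed
qed

lemma inj_\<beta>: "inj_on \<beta> (carrier A)"
  by (rule inj_onI) (simp add: le_antisym flip: \<beta>_subset_iff)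

lemma K_eqpoll: "K \<approx> carrier A"
proof -
  have "inj_on (\<lambda>a. X - \<beta> a) (carrier A)"
  proof (rule inj_onI)
    fix a b assume "a \<in> carrier A" "b \<in> carrier A" "X - \<beta> a = X - \<beta> b"
    moreover from this have "\<beta> a = \<beta> b"
      using \<beta>_subset by blast
    ultimately show "a = b"
      using inj_\<beta> by (simp add: inj_on_eq_iff)
  qed
  then show ?thesis
    unfolding K_def by (simp add: inj_on_image_eqpoll_self)
qed

lemma Union_K: "\<Union>K = X"
proof -
  have "\<exists>a\<in>carrier A. x \<notin> \<beta> a" if "x \<in> X" for x
  proof -
    have "F x \<noteq> carrier A" "F x \<subseteq> carrier A"
      using F_irreducible[OF that] filter_subset[OF F_filter[OF that]]
      unfolding irreducible_filters_def by auto
    then show ?thesis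
      unfolding \<beta>_def by blast
  qed
  then show ?thesis
    unfolding K_def by blast
qed

lemma t0: "t0_space (topology_generated_by K)"
  unfolding t0_space_def topology_generated_by_topspace Union_K
proof (intro ballI impI)
  fix x y assume xy: "x \<in> X" "y \<in> X" "x \<noteq> y"
  then have "F x \<noteq> F y"
    using points by (auto simp: bij_betw_def inj_on_def)
  then obtain a where a: "a \<in> carrier A" "a \<in> F x \<longleftrightarrow> a \<notin> F y"
    using filter_carrier[OF F_filter] xy by blast
  then have "x \<notin> X - \<beta> a \<longleftrightarrow> y \<in> X - \<beta> a"
    using xy by (auto simp: \<beta>_def)
  moreover have "openin (topology_generated_by K) (X - \<beta> a)"
    using a by (auto simp: K_def intro!: topology_generated_by_Basis)
  ultimately show "\<exists>U. openin (topology_generated_by K) U \<and> (x \<notin> U \<longleftrightarrow> y \<in> U)"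
    by blast
qed

text \<open>If every irreducible filter containing \<open>B\<close> contains \<open>a\<close>, then \<open>a\<close> lies in the filter generated by
  \<open>B\<close>, hence in one generated by finitely many elements of \<open>B\<close>. With Alexander's subbase lemma this is
  compactness of the complement of \<open>\<beta> a\<close>.\<close>

lemma compact:
  assumes "U \<in> K"
  shows "compactin (topology_generated_by K) U"
proof (rule compactin_topology_generated_by_subbase)
  show "U \<subseteq> \<Union>K"
    using assms by blast
  fix C assume C: "C \<subseteq> K" "U \<subseteq> \<Union>C"
  obtain a where a: "a \<in> carrier A" "U = X - \<beta> a"
    using assms by (auto simp: K_def)
  define B where "B = {b \<in> carrier A. X - \<beta> b \<in> C}"
  have C_eq: "C = (\<lambda>b. X - \<beta> b) ` B"
    using C(1) unfolding B_def K_def by blast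
  have "a \<in> filter_generated B"
  proof (rule ccontr)
    assume "a \<notin> filter_generated B"
    then obtain x where x: "x \<in> X" "filter_generated B \<subseteq> F x" "a \<notin> F x"
      using separating_point_element[OF filter_generated_filter a(1)] by blast
    have "B \<subseteq> F x"
      using x(2) filter_generated_subset_iff[OF F_filter[OF x(1)], of B] by (auto simp: B_def)
    then have "x \<notin> \<Union>C"
      unfolding C_eq \<beta>_def using x(1) by blast
    moreover have "x \<in> U"
      unfolding a(2) \<beta>_def using x by blast
    ultimately show False
      using C(2) by blast
  qed
  then obtain B' where B': "finite B'" "B' \<subseteq> B" "a \<in> filter_generated B'"
    by (rule filter_generated_finite)
  have "U \<subseteq> \<Union>((\<lambda>b. X - \<beta> b) ` B')"
  proof
    fix x assume "x \<in> U"
    then have x: "x \<in> X" "a \<notin> F x"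
      unfolding a(2) \<beta>_def by auto
    then have "\<not> B' \<subseteq> F x"
      using filter_generated_least[OF F_filter[OF x(1)]] B'(3) by blast
    then show "x \<in> \<Union>((\<lambda>b. X - \<beta> b) ` B')"
      using x(1) unfolding \<beta>_def by blast
  qed
  then show "\<exists>C'. finite C' \<and> C' \<subseteq> C \<and> U \<subseteq> \<Union>C'"
    using B'(1,2) unfolding C_eq by (intro exI[of _ "(\<lambda>b. X - \<beta> b) ` B'"]) auto
qed

lemma irreducible_axiom:
  assumes "U \<in> K" "V \<in> K" "x \<in> U \<inter> V"
  shows "\<exists>W\<in>K. \<exists>D\<in>K. x \<notin> W \<and> x \<in> D \<and> D \<subseteq> (U \<inter> V) \<union> W"
proof -
  obtain a b where ab: "a \<in> carrier A" "b \<in> carrier A" "U = X - \<beta> a" "V = X - \<beta> b"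
    using assms(1,2) by (auto simp: K_def)
  then have x: "x \<in> X" "a \<notin> F x" "b \<notin> F x"
    using assms(3) by (auto simp: \<beta>_def)
  then obtain c d where cd: "c \<in> F x" "d \<in> carrier A" "d \<notin> F x" "a \<otimes> c \<preceq> d" "b \<otimes> c \<preceq> d"
    using F_irreducible[OF x(1)] ab(1,2) unfolding irreducible_filters_def by fastforce
  have c: "c \<in> carrier A"
    using filter_carrier[OF F_filter[OF x(1)] cd(1)] .
  have "\<beta> a \<inter> \<beta> c \<subseteq> \<beta> d" "\<beta> b \<inter> \<beta> c \<subseteq> \<beta> d"
    using cd c ab(1,2) by (simp_all add: \<beta>_subset_iff flip: \<beta>_meet)
  then have "X - \<beta> d \<subseteq> (U \<inter> V) \<union> (X - \<beta> c)"
    unfolding ab(3,4) by blast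
  moreover have "x \<notin> X - \<beta> c" "x \<in> X - \<beta> d"
    using cd x(1) by (auto simp: \<beta>_def)
  ultimately show ?thesis
    using c cd(2) by (intro bexI[of _ "X - \<beta> c"] bexI[of _ "X - \<beta> d"]) (auto simp: K_def)
qed

text \<open>The set \<open>Y\<close> consists of the points above a filter \<open>G\<close>, and a \<open>Y\<close>-family is a set of elements directed
  modulo \<open>G\<close>, so the last axiom of an \<open>S\<close>-space is the separation lemma.\<close>

lemma Y_family_axiom:
  assumes Y: "Y \<in> C_fam X K" and J: "Y_family X K Y J" and meets: "\<And>U. U \<in> J \<Longrightarrow> Y \<inter> (X - U) \<noteq> {}"
  shows "Y \<inter> \<Inter>{X - U | U. U \<in> J} \<noteq> {}"
proof -
  obtain \<A> where \<A>: "\<A> \<subseteq> S_fam X K" "Y = X \<inter> \<Inter>\<A>"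
    using Y by (auto simp: C_fam_def)
  define G where "G = filter_generated {a \<in> carrier A. \<beta> a \<in> \<A>}"
  have G: "is_filter G"
    unfolding G_def by (rule filter_generated_filter)
  have Y_iff: "x \<in> Y \<longleftrightarrow> x \<in> X \<and> G \<subseteq> F x" for x
  proof -
    have "x \<in> Y \<longleftrightarrow> x \<in> X \<and> (\<forall>a\<in>carrier A. \<beta> a \<in> \<A> \<longrightarrow> x \<in> \<beta> a)"
      using \<A> unfolding S_fam_eq by blast
    also have "\<dots> \<longleftrightarrow> x \<in> X \<and> {a \<in> carrier A. \<beta> a \<in> \<A>} \<subseteq> F x"
      unfolding \<beta>_def by blast
    also have "\<dots> \<longleftrightarrow> x \<in> X \<and> G \<subseteq> F x"
      unfolding G_def
      using filter_generated_subset_iff[OF F_filter, of x "{a \<in> carrier A. \<beta> a \<in> \<A>}"] by auto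
    finally show ?thesis .
  qed
  have G_iff: "h \<in> G \<longleftrightarrow> Y \<subseteq> \<beta> h" if h: "h \<in> carrier A" for h
  proof
    assume "h \<in> G"
    then show "Y \<subseteq> \<beta> h"
      unfolding \<beta>_def using Y_iff by blast
  next
    assume sub: "Y \<subseteq> \<beta> h"
    show "h \<in> G"
    proof (rule ccontr)
      assume "h \<notin> G"
      then obtain x where "x \<in> X" "G \<subseteq> F x" "h \<notin> F x"
        using separating_point_element[OF G h] by blast
      then show False
        using sub Y_iff unfolding \<beta>_def by blast
    qed
  qed
  define J' where "J' = {a \<in> carrier A. \<beta> a \<in> J}"
  have J_eq: "J = \<beta> ` J'"
    using J unfolding J'_def Y_family_def S_fam_eq by blast
  have J'_c: "J' \<subseteq> carrier A"
    unfolding J'_def by blast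
  have "J' \<noteq> {}"
    using J J_eq unfolding Y_family_def by blast
  moreover have "a \<notin> G" if "a \<in> J'" for a
  proof -
    have "Y \<inter> (X - \<beta> a) \<noteq> {}"
      using meets that unfolding J_eq by blast
    then show ?thesis
      using G_iff J'_c that by blast
  qed
  then have "G \<inter> J' = {}"
    by blast
  moreover have "\<exists>h\<in>G. \<exists>c\<in>J'. a \<otimes> h \<preceq> c \<and> b \<otimes> h \<preceq> c" if ab: "a \<in> J'" "b \<in> J'" for a b
  proof -
    have "\<beta> a \<in> J" "\<beta> b \<in> J"
      using ab J_eq by auto
    then obtain H C where HC: "H \<in> S_fam X K" "Y \<subseteq> H" "C \<in> J" "\<beta> a \<inter> H \<subseteq> C" "\<beta> b \<inter> H \<subseteq> C"
      using J unfolding Y_family_def by meson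
    then obtain h c where hc: "h \<in> carrier A" "H = \<beta> h" "c \<in> J'" "C = \<beta> c"
      unfolding S_fam_eq J_eq by blast
    have abc: "a \<in> carrier A" "b \<in> carrier A" "c \<in> carrier A"
      using ab hc J'_c by auto
    then have "a \<otimes> h \<preceq> c" "b \<otimes> h \<preceq> c"
      using HC(4,5) hc by (simp_all add: \<beta>_meet flip: \<beta>_subset_iff)
    then show ?thesis
      using HC(2) hc G_iff by blast
  qed
  ultimately obtain x where x: "x \<in> X" "G \<subseteq> F x" "F x \<inter> J' = {}"
    using separating_point[OF G J'_c] by blast
  then have "x \<in> Y"
    using Y_iff by blast
  moreover have "x \<in> X - U" if "U \<in> J" for U
    using x that unfolding J_eq \<beta>_def by blast
  ultimately show ?thesis
    by blast
qed

lemma S_space: "S_space X K"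
  unfolding S_space_def
proof (intro conjI ballI allI impI)
  show "{} \<in> K"
    unfolding K_def using \<beta>_one by (intro image_eqI[of _ _ \<one>]) simp_all
  fix U V assume "U \<in> K" "V \<in> K"
  then obtain a b where "a \<in> carrier A" "b \<in> carrier A" "U = X - \<beta> a" "V = X - \<beta> b"
    by (auto simp: K_def)
  then show "U \<union> V \<in> K"
    unfolding K_def by (intro image_eqI[of _ _ "a \<otimes> b"]) (auto simp: \<beta>_meet)
next
  fix U V x assume "U \<in> K" "V \<in> K" "x \<in> U \<inter> V"
  then show "\<exists>W\<in>K. \<exists>D\<in>K. x \<notin> W \<and> x \<in> D \<and> D \<subseteq> (U \<inter> V) \<union> W"
    by (rule irreducible_axiom)
qed (simp_all add: t0 Union_K compact Y_family_axiom)

text \<open>The largest multirelation \<open>R\<close> with \<open>\<beta> (m a) \<subseteq> m\<^sub>R (\<beta> a)\<close> for all \<open>a\<close>; for monotone \<open>m\<close> the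
  inclusion is an equality.\<close>

definition multirel :: "('a \<Rightarrow> 'a) \<Rightarrow> ('x \<times> 'x set) set" where
  "multirel m = {(x, Z) \<in> X \<times> Z_fam X K. \<forall>a\<in>carrier A. m a \<in> F x \<longrightarrow> Z \<inter> \<beta> a \<noteq> {}}"

text \<open>If \<open>m a\<close> is not in \<open>F x\<close>, the complement of \<open>\<beta> a\<close> is itself related to \<open>x\<close>, since a \<open>b\<close> with
  \<open>\<beta> b \<subseteq> \<beta> a\<close> has \<open>m b \<preceq> m a\<close>.\<close>

lemma m_op_multirel:
  assumes m: "\<And>a. a \<in> carrier A \<Longrightarrow> m a \<in> carrier A"
    and mono: "\<And>a b. a \<in> carrier A \<Longrightarrow> b \<in> carrier A \<Longrightarrow> a \<preceq> b \<Longrightarrow> m a \<preceq> m b"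
    and a: "a \<in> carrier A"
  shows "m_op X K (multirel m) (\<beta> a) = \<beta> (m a)"
proof
  show "\<beta> (m a) \<subseteq> m_op X K (multirel m) (\<beta> a)"
    using a unfolding m_op_def L_fam_def multirel_def \<beta>_def[of "m a"] by blast
  show "m_op X K (multirel m) (\<beta> a) \<subseteq> \<beta> (m a)"
  proof
    fix x assume "x \<in> m_op X K (multirel m) (\<beta> a)"
    then have x: "x \<in> X" and sub: "\<And>Z. (x, Z) \<in> multirel m \<Longrightarrow> Z \<inter> \<beta> a \<noteq> {}"
      unfolding m_op_def L_fam_def by auto
    show "x \<in> \<beta> (m a)"
    proof (rule ccontr)
      assume "x \<notin> \<beta> (m a)"
      then have "m a \<notin> F x"
        using x unfolding \<beta>_def by blast
      then have "(X - \<beta> a) \<inter> \<beta> b \<noteq> {}" if "b \<in> carrier A" "m b \<in> F x" for b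
        using that a m mono \<beta>_subset_iff[of b a] filter_up[OF F_filter[OF x]] \<beta>_subset[of b] by blast
      moreover have "X - \<beta> a \<in> Z_fam X K"
        unfolding Z_fam_def K_def using a by (intro CollectI exI[of _ "{X - \<beta> a}"]) auto
      ultimately have "(x, X - \<beta> a) \<in> multirel m"
        unfolding multirel_def using x by blast
      then show False
        using sub by blast
    qed
  qed
qed

text \<open>The closure condition holds by construction: \<open>multirel m\<close> is defined as the intersection of the
  families \<open>L\<^bsub>\<beta> a\<^esub>\<close> with \<open>m a \<in> F x\<close>, and \<open>m a \<in> F x\<close> means \<open>x \<in> m\<^sub>R (\<beta> a)\<close>.\<close>

lemma mS_space_multirel:
  assumes m: "\<And>a. a \<in> carrier A \<Longrightarrow> m a \<in> carrier A"
    and mono: "\<And>a b. a \<in> carrier A \<Longrightarrow> b \<in> carrier A \<Longrightarrow> a \<preceq> b \<Longrightarrow> m a \<preceq> m b"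
  shows "mS_space X K (multirel m)"
  unfolding mS_space_def
proof (intro conjI ballI)
  note mm = m_op_multirel[of m, OF m mono]
  show "multirel m \<subseteq> X \<times> Z_fam X K"
    unfolding multirel_def by blast
  show "m_op X K (multirel m) U \<in> S_fam X K" if "U \<in> S_fam X K" for U
    using that mm m unfolding S_fam_eq by auto
  show "multirel m `` {x} =
      Z_fam X K \<inter> \<Inter>{L_fam X K U | U. U \<in> S_fam X K \<and> x \<in> m_op X K (multirel m) U}" if x: "x \<in> X" for x
  proof -
    have "{L_fam X K U | U. U \<in> S_fam X K \<and> x \<in> m_op X K (multirel m) U} =
        L_fam X K ` \<beta> ` {a \<in> carrier A. m a \<in> F x}"
      using mm x unfolding S_fam_eq by (auto simp: \<beta>_def[of "m _"])
    moreover have "multirel m `` {x} = Z_fam X K \<inter> \<Inter>(L_fam X K ` \<beta> ` {a \<in> carrier A. m a \<in> F x})"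
      using x by (simp add: multirel_def L_fam_def set_eq_iff) blast
    ultimately show ?thesis
      by simp
  qed
qed (rule S_space)

end

text \<open>Both operators of an adjunction are monotone, and unit and counit pass from the algebra to the
  space through \<open>\<beta>\<close>.\<close>

lemma dual_slata_space:
  fixes A :: "'a slata" and X :: "'x set"
  assumes A: "is_slata A" and "dual_space A X F"
  obtains P :: "'x slata_space" and \<phi> where "coding P A \<phi>" "subb P \<approx> carrier A"
proof -
  interpret dual_space A X F by fact
  have adj: "op_i A a \<preceq> b \<longleftrightarrow> a \<preceq> op_d A b" if "a \<in> carrier A" "b \<in> carrier A" for a b
    using A that by (simp add: is_slata_def)
  note i = slata_i[OF A] and d = slata_d[OF A]
  have unit: "a \<preceq> op_d A (op_i A a)" and counit: "op_i A (op_d A a) \<preceq> a" if "a \<in> carrier A" for a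
    using adj that i d le_refl by blast+
  have i_mono: "op_i A a \<preceq> op_i A b" if "a \<in> carrier A" "b \<in> carrier A" "a \<preceq> b" for a b
    using that adj i d unit le_trans by metis
  have d_mono: "op_d A a \<preceq> op_d A b" if "a \<in> carrier A" "b \<in> carrier A" "a \<preceq> b" for a b
    using that adj i d counit le_trans by metis
  define P where "P = \<lparr>pts = X, subb = K, rel_I = multirel (op_i A), rel_D = multirel (op_d A)\<rparr>"
  have P: "pts P = X" "subb P = K" "rel_I P = multirel (op_i A)" "rel_D P = multirel (op_d A)"
    by (simp_all add: P_def)
  note mI = m_op_multirel[of "op_i A", OF i i_mono] and mD = m_op_multirel[of "op_d A", OF d d_mono]
  have "is_slata_space P"
    by (subst slata_space_iff_unit_counit)
      (simp_all add: P mS_space_multirel i d i_mono d_mono S_fam_eq mI mD \<beta>_subset_iff unit counit)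
  moreover define \<phi> where "\<phi> = inv_into (carrier A) \<beta>"
  have \<phi>: "\<phi> (\<beta> a) = a" if "a \<in> carrier A" for a
    unfolding \<phi>_def using inj_\<beta> that by simp
  have "bij_betw \<phi> (\<beta> ` carrier A) (carrier A)"
    unfolding \<phi>_def by (intro bij_betw_inv_into inj_on_imp_bij_betw inj_\<beta>)
  moreover have "\<phi> X = \<one>\<^bsub>A\<^esub>"
    using \<phi>[OF one_closed] by (simp add: \<beta>_one)
  moreover have "\<phi> (\<beta> a \<inter> \<beta> b) = a \<otimes>\<^bsub>A\<^esub> b" if "a \<in> carrier A" "b \<in> carrier A" for a b
    using \<phi>[of "a \<otimes>\<^bsub>A\<^esub> b"] that by (simp add: \<beta>_meet)
  ultimately have "coding P A \<phi>"
    by unfold_locales (auto simp: P S_fam_eq mI mD \<phi> i d)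
  then show ?thesis
    using that K_eqpoll P(2) by metis
qed

text \<open>The points of the dual space are subsets of the carrier, so they fit into \<open>'x\<close> as soon as the power
  set of the carrier does; its subbase has the size of the carrier, which makes the space small.\<close>

lemma dual_functor_essentially_surjective:
  fixes small :: "'a set \<Rightarrow> bool"
  assumes "\<And>A. small A \<Longrightarrow> Pow A \<lesssim> (UNIV :: 'x set)" and A: "A \<in> Obj (SLata small)"
  shows "\<exists>P\<in>Obj (SLataSp small :: ('x slata_space, ('x \<times> 'x) set) category). \<exists>f.
    is_iso (SLata small) (OMap (dual_functor small) P) A f"
proof -
  have slata: "is_slata A" and small: "small (carrier A)"
    using A by (simp_all add: SLata_simps)
  interpret meet_semilattice A
    using is_slata_imp_meet_semilattice[OF slata] .
  obtain e :: "'a set \<Rightarrow> 'x" where "inj_on e (Pow (carrier A))"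
    using assms(1)[OF small] unfolding lepoll_def by blast
  moreover have "irreducible_filters \<subseteq> Pow (carrier A)"
    unfolding irreducible_filters_def using filter_subset by auto
  ultimately have "bij_betw e irreducible_filters (e ` irreducible_filters)"
    by (intro inj_on_imp_bij_betw) (rule inj_on_subset)
  then have "dual_space A (e ` irreducible_filters) (inv_into irreducible_filters e)"
    by unfold_locales (rule bij_betw_inv_into)
  then obtain P :: "'x slata_space" and \<phi> where P: "coding P A \<phi>" "subb P \<approx> carrier A"
    using dual_slata_space[OF slata] by blast
  then have "P \<in> Obj (SLataSp small)"
    using small coding.space[OF P(1)] by (auto simp: SLataSp_simps)
  then show ?thesis
    using codings_isomorphic[OF dual_functor_coding(1) P(1)] by blast
qed

theorem theorem3p1:
  fixes small :: "'a set \<Rightarrow> bool"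
  assumes "\<And>A. small A \<Longrightarrow> Pow A \<lesssim> (UNIV :: 'x set)"
  shows "dually_equivalent
           (SLataSp small :: ('x slata_space, ('x \<times> 'x) set) category)
           (SLata small)"
  unfolding dually_equivalent_def
proof (rule fully_faithful_essentially_surjective_imp_equivalent)
  show "is_functor (opposite (SLataSp small)) (SLata small)
      (dual_functor small :: ('x slata_space, _, _, _) functr)"
    by (rule is_functor_dual_functor)
qed (simp_all add: is_category_opposite is_category_SLataSp is_category_SLata opposite_simps
  SLataSp_simps(2) SLata_simps(2) dual_functor_fully_faithful
  dual_functor_essentially_surjective[OF assms])

end
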